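(* Geometric input probability distributions minimize the output Shannon entropy of the thinning for fixed input entropy; i.e., for any probability distribution $p$ on $\mathbb N$ and any $0\le\lambda\le1$, $$H\left(T_\lambda(p)\right)\ \ge\ g\left(\lambda\,g^{-1}\left(H(p)\right)\right).$$
   Context: $\mathbb N=\{0,1,2,\dots\}$. $H(p)=-\sum_{n}p_n\ln p_n\in[0,\infty]$ is the Shannon entropy. Thinning: if $N$ is an $\mathbb N$-valued random variable with distribution $p$, then $T_\lambda(N)=\sum_{i=1}^N B_i$, where $B_1,B_2,\dots$ are Bernoulli variables with parameter $\lambda$ (equal to $1$ with probability $\lambda$ and $0$ with probability $1-\lambda$), independent of each other and of $N$, and $T_\lambda(p)$ denotes the distribution of $T_\lambda(N)$. Explicitly, $[T_\lambda(p)]_n=\sum_{k=n}^\infty\binom kn\lambda^n(1-\lambda)^{k-n}p_k$. The function $g:[0,\infty)\to[0,\infty)$ is $g(E)=(E+1)\ln(E+1)-E\ln E$ with $g(0)=0$; it is a continuous strictly increasing bijection, with inverse $g^{-1}$. It is the entropy of the geometric distribution $p_n=\frac1{E+1}\left(\frac E{E+1}\right)^n$ of mean $E$, which is mapped by $T_\lambda$ to the geometric distribution of mean $\lambda E$. If $H(p)=\infty$, one uses the conventions $g^{-1}(\infty)=\infty$, $g(\infty)=\infty$ and $0\cdot\infty=0$. *)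

theory Defs
  imports "HOL-Probability.Probability"
begin

text \<open>The Isabelle convention \<open>ln 0 = 0\<close> makes the terms with \<open>pmf p n = 0\<close> vanish; all terms are
  nonnegative, so the sum is taken in \<open>[0, \<infinity>]\<close>.\<close>

definition shannon_entropy :: "nat pmf \<Rightarrow> ennreal" where
  "shannon_entropy p = (\<Sum>n. ennreal (- (pmf p n * ln (pmf p n))))"

text \<open>The law of \<open>B 1 + \<dots> + B N\<close> where \<open>N\<close> has law \<open>p\<close> and the \<open>B i\<close> are Bernoulli variables,
  independent of each other and of \<open>N\<close>; \<open>False\<close> is only the dummy value of \<open>B i\<close> outside
  \<open>{1..N}\<close>.\<close>

definition thinning :: "real \<Rightarrow> nat pmf \<Rightarrow> nat pmf" where
  "thinning l p =
     bind_pmf p (\<lambda>N. map_pmf (\<lambda>B. \<Sum>i\<in>{1..N}. of_bool (B i))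
                        (Pi_pmf {1..N} False (\<lambda>_. bernoulli_pmf l)))"

lemma thinning_binomial:
  assumes "0 \<le> l" "l \<le> 1"
  shows "thinning l p = bind_pmf p (\<lambda>N. binomial_pmf N l)"
  unfolding thinning_def
proof (intro bind_pmf_cong refl)
  fix N
  have "(\<Sum>i\<in>{1..N}. of_bool (B i)) = card {i\<in>{1..N}. B i}" for B :: "nat \<Rightarrow> bool"
    by (simp add: of_bool_def sum.If_cases Int_def)
  then show "map_pmf (\<lambda>B. \<Sum>i\<in>{1..N}. of_bool (B i)) (Pi_pmf {1..N} False (\<lambda>_. bernoulli_pmf l))
      = binomial_pmf N l"
    using assms by (subst binomial_pmf_altdef'[of "{1..N}" N l False]) auto
qed

text \<open>The terms with \<open>k < n\<close> vanish because \<open>k choose n = 0\<close>.\<close>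

lemma pmf_thinning_sums:
  assumes "0 \<le> l" "l \<le> 1"
  shows "(\<lambda>k. real (k choose n) * l ^ n * (1 - l) ^ (k - n) * pmf p k) sums pmf (thinning l p) n"
proof -
  let ?f = "\<lambda>k. real (k choose n) * l ^ n * (1 - l) ^ (k - n) * pmf p k"
  have nonneg: "0 \<le> ?f k" for k
    using assms by simp
  have "ennreal (pmf (thinning l p) n)
      = (\<integral>\<^sup>+k. ennreal (pmf (binomial_pmf k l) n) \<partial>measure_pmf p)"
    by (simp add: thinning_binomial[OF assms] ennreal_pmf_bind)
  also have "\<dots> = (\<integral>\<^sup>+k. ennreal (pmf p k) * ennreal (pmf (binomial_pmf k l) n) \<partial>count_space UNIV)"
    by (rule nn_integral_measure_pmf)
  also have "\<dots> = (\<Sum>k. ennreal (?f k))"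
    unfolding nn_integral_count_space_nat using assms
    by (intro suminf_cong) (simp add: ennreal_mult[symmetric] mult_ac)
  finally have *: "(\<Sum>k. ennreal (?f k)) = ennreal (pmf (thinning l p) n)" by simp
  have "(\<lambda>k. ennreal (?f k)) sums ennreal (pmf (thinning l p) n)"
    using summable_sums[of "\<lambda>k. ennreal (?f k)"] unfolding * by simp
  then show ?thesis
    using nonneg by (subst (asm) sums_ennreal) auto
qed

definition g_real :: "real \<Rightarrow> real" where
  "g_real E = (E + 1) * ln (E + 1) - E * ln E"

definition g_fun :: "ennreal \<Rightarrow> ennreal" where
  "g_fun E = (if E = \<infinity> then \<infinity> else ennreal (g_real (enn2real E)))"

definition g_inv :: "ennreal \<Rightarrow> ennreal" where
  "g_inv = inv g_fun"

lemma g_real_0: "g_real 0 = 0"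
  by (simp add: g_real_def)

lemma g_real_continuous_on: "continuous_on {0..} g_real"
proof -
  have "continuous (at x within {0..}) (\<lambda>x::real. x * ln x)" if "x \<ge> 0" for x
  proof (cases "x = 0")
    case True
    have "((\<lambda>x::real. x * ln x) \<longlongrightarrow> 0) (at_right 0)" by real_asymp
    then show ?thesis
      using True by (simp add: continuous_within at_within_Ici_at_right)
  next
    case False
    then show ?thesis using that by (intro continuous_intros) auto
  qed
  then have "continuous_on {0..} (\<lambda>x::real. x * ln x)"
    by (simp add: continuous_on_eq_continuous_within)
  then show ?thesis
    unfolding g_real_def by (intro continuous_on_diff) (auto intro!: continuous_intros)
qed

lemma g_real_strict_mono: "strict_mono_on {0..} g_real"
proof (rule strict_mono_onI)
  fix a b :: real
  assume ab: "a \<in> {0..}" "b \<in> {0..}" "a < b"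
  show "g_real a < g_real b"
  proof (rule DERIV_pos_imp_increasing_open[of a b g_real])
    show "a < b" by fact
    show "\<exists>y. (g_real has_real_derivative y) (at x) \<and> 0 < y" if "a < x" "x < b" for x
    proof (intro exI conjI)
      show "(g_real has_real_derivative (ln (x + 1) - ln x)) (at x)"
        unfolding g_real_def using ab that
        by (auto intro!: derivative_eq_intros simp: field_simps)
      show "0 < ln (x + 1) - ln x" using ab that by simp
    qed
    show "continuous_on {a..b} g_real"
      using ab by (intro continuous_on_subset[OF g_real_continuous_on]) auto
  qed
qed

lemma g_real_nonneg: "0 \<le> E \<Longrightarrow> 0 \<le> g_real E"
  using strict_mono_onD[OF g_real_strict_mono, of 0 E] g_real_0 by (cases "E = 0") auto

lemma g_real_bij_betw: "bij_betw g_real {0..} {0..}"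
  unfolding bij_betw_def
proof
  show "inj_on g_real {0..}"
    by (rule strict_mono_on_imp_inj_on[OF g_real_strict_mono])
  show "g_real ` {0..} = {0..}"
  proof (intro equalityI subsetI)
    fix y :: real assume "y \<in> {0..}"
    have "filterlim g_real at_top at_top" unfolding g_real_def by real_asymp
    then have "eventually (\<lambda>E. g_real E \<ge> y \<and> E \<ge> 0) at_top"
      by (intro eventually_conj) (auto simp: filterlim_at_top eventually_ge_at_top)
    then obtain E where E: "g_real E \<ge> y" "E \<ge> 0"
      using eventually_happens[of _ "at_top :: real filter"] by auto
    have "\<exists>x\<ge>0. x \<le> E \<and> g_real x = y"
      using E \<open>y \<in> {0..}\<close> g_real_0
      by (intro IVT' continuous_on_subset[OF g_real_continuous_on]) auto
    then show "y \<in> g_real ` {0..}" by auto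
  qed (use g_real_nonneg in auto)
qed

lemma g_fun_ennreal: "0 \<le> E \<Longrightarrow> g_fun (ennreal E) = ennreal (g_real E)"
  by (simp add: g_fun_def)

lemma g_fun_bij: "bij g_fun"
proof (rule bijI)
  show "inj g_fun"
  proof (rule injI)
    fix x y assume eq: "g_fun x = g_fun y"
    show "x = y"
      using eq g_real_nonneg bij_betw_imp_inj_on[OF g_real_bij_betw]
      by (cases x; cases y) (auto simp: g_fun_def inj_on_eq_iff)
  qed
  have "\<exists>x. g_fun x = y" for y
  proof (cases y)
    case (real r)
    then obtain E where "E \<ge> 0" "g_real E = r"
      using bij_betw_imp_surj_on[OF g_real_bij_betw] by (metis atLeast_iff imageE)
    then show ?thesis using real g_fun_ennreal by metis
  next
    case top
    then show ?thesis by (auto simp: g_fun_def intro!: exI[of _ \<infinity>])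
  qed
  then show "surj g_fun" by (metis surjI)
qed

lemma g_inv_g_fun: "g_inv (g_fun x) = x"
  unfolding g_inv_def using g_fun_bij by (simp add: bij_is_inj)

lemma g_fun_g_inv: "g_fun (g_inv y) = y"
  unfolding g_inv_def using g_fun_bij by (simp add: bij_is_surj surj_f_inv_f)

lemma g_inv_infinity: "g_inv \<infinity> = \<infinity>"
  using g_inv_g_fun[of \<infinity>] by (simp add: g_fun_def)

definition geometric_mean_pmf :: "real \<Rightarrow> nat pmf" where
  "geometric_mean_pmf E = geometric_pmf (1 / (E + 1))"

lemma pmf_geometric_mean:
  assumes "0 \<le> E"
  shows "pmf (geometric_mean_pmf E) n = 1 / (E + 1) * (E / (E + 1)) ^ n"
proof -
  have "1 - 1 / (E + 1) = E / (E + 1)" using assms by (simp add: field_simps)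
  then show ?thesis using assms by (simp add: geometric_mean_pmf_def)
qed

end

theory Submission
  imports Defs
begin

text \<open>
  Thinning is a flow in \<open>t = ln l\<close>, namely \<open>dp\<^sub>n/dt = n p\<^sub>n - (n + 1) p\<^sub>n\<^sub>+\<^sub>1\<close>, along which the entropy grows
  at the rate \<open>J(p) = \<Sum>n. n p\<^sub>n ln (p\<^sub>n\<^sub>-\<^sub>1 / p\<^sub>n)\<close>; for a geometric law of mean \<open>E\<close> this is
  \<open>\<phi>(E) = E ln (1 + 1/E)\<close>. It suffices to show \<open>J(p) \<le> \<phi>(g\<inverse>(H(p)))\<close> for finitely supported \<open>p\<close>, since
  then \<open>H\<close> cannot fall below the entropy of the geometric flow.

  Rearranging \<open>p\<close> into nonincreasing order keeps \<open>H\<close> and does not decrease \<open>J\<close>. For nonincreasing \<open>p\<close>,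
  \<open>dJ/dt \<le> J - 1 + Y\<close> with \<open>Y = \<Sum>n. n (p\<^sub>n\<^sub>-\<^sub>1 - p\<^sub>n)\<^sup>2 / p\<^sub>n\<^sub>-\<^sub>1\<close>, and \<open>1 - J\<close> and \<open>Y\<close> are the means of
  \<open>1 + (1 - s) ln (1 - s) / s\<close> and of \<open>s = 1 - p\<^sub>n / p\<^sub>n\<^sub>-\<^sub>1\<close> under the probability weights
  \<open>n (p\<^sub>n\<^sub>-\<^sub>1 - p\<^sub>n)\<close>, so Jensen's inequality bounds \<open>Y\<close> in terms of \<open>J\<close>. The resulting differential
  inequality for \<open>J\<close> is an equality for geometric laws; hence if \<open>J(p) > \<phi>(E)\<close> with \<open>g(E) = H(p)\<close>, then \<open>J\<close>
  stays above the geometric rate for all smaller \<open>l\<close>, and integrating from \<open>l = 1\<close> down to \<open>l = 0\<close> makes the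
  entropy negative.
\<close>

subsection \<open>Convexity of the entropy defect\<close>

text \<open>The difference of the two sides vanishes at 1 and has derivative
  \<open>(1 - 1 / x)\<^sup>2\<close>. At \<open>y = 1 / (1 - s)\<close> this gives the sign of
  \<open>h''\<close> in the next lemma.\<close>

lemma ln_sub_inverse_le:
  fixes y :: real
  assumes "1 \<le> y"
  shows "2 * ln y \<le> y - 1 / y"
proof -
  let ?f = "\<lambda>y::real. y - 1 / y - 2 * ln y"
  have "?f 1 \<le> ?f y"
  proof (rule DERIV_nonneg_imp_nondecreasing[OF assms])
    fix x :: real assume x: "1 \<le> x" "x \<le> y"
    have "(?f has_real_derivative (1 + 1 / x\<^sup>2 - 2 / x)) (at x)"
      using x by (auto intro!: derivative_eq_intros simp: power2_eq_square)
    moreover have "1 + 1 / x\<^sup>2 - 2 / x = (1 - 1 / x)\<^sup>2"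
      by (simp add: power2_diff power_divide)
    ultimately show "\<exists>d. (?f has_real_derivative d) (at x) \<and> 0 \<le> d" by auto
  qed
  then show ?thesis by simp
qed

text \<open>Up to the factor \<open>s\<close>, the right-hand side is the convex function \<open>1 + (1 - s) * ln (1 - s) / s\<close>
  and the left-hand side its tangent at \<open>1 / (e + 1)\<close>.\<close>

lemma entropy_defect_tangent:
  fixes e s :: real
  assumes e: "0 < e" and s: "0 \<le> s" "s \<le> 1"
  defines "L \<equiv> ln ((e + 1) / e)"
  defines "A \<equiv> (e + 1) * ((e + 1) * L - 1)"
  shows "s * (1 - e * L + A * (s - 1 / (e + 1))) \<le> (1 - s) * ln (1 - s) + s"
proof -
  let ?c = "1 / (e + 1)"
  define h where "h = (\<lambda>s::real. 1 + ln (1 - s) / s - ln (1 - s))"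
  define h' where "h' = (\<lambda>s::real. - (1 / s) - ln (1 - s) / s\<^sup>2)"
  define h'' where "h'' = (\<lambda>s::real. 1 / s\<^sup>2 + 1 / (s\<^sup>2 * (1 - s)) + 2 * ln (1 - s) / s ^ 3)"
  have c: "?c \<in> {0<..<1}" using e by auto
  have c1: "ln (1 - ?c) = - L"
  proof -
    have "1 - ?c = e / (e + 1)" using e by (simp add: field_simps)
    then show ?thesis using e by (simp add: L_def ln_div)
  qed
  have hc: "h ?c = 1 - e * L"
    unfolding h_def c1 using e by (simp add: algebra_simps)
  have h'c: "h' ?c = A"
    unfolding h'_def c1 A_def using e by (simp add: power_divide power2_eq_square algebra_simps)
  have tan: "h' ?c * (s - ?c) \<le> h s - h ?c" if s: "s \<in> {0<..<1}" for s
  proof (rule f''_imp_f'[of "{0<..<1}" h h' h''])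
    fix x :: real assume x: "x \<in> {0<..<1}"
    have "DERIV h x :> (- 1 / (1 - x) * x - ln (1 - x)) / (x * x) + 1 / (1 - x)"
      unfolding h_def using x by (auto intro!: derivative_eq_intros)
    also have "(- 1 / (1 - x) * x - ln (1 - x)) / (x * x) + 1 / (1 - x) = h' x"
      unfolding h'_def using x
      by (simp add: divide_simps power2_eq_square) (simp add: algebra_simps)
    finally show "DERIV h x :> h' x" .
    have "DERIV h' x :> 1 / (x * x) - (- 1 / (1 - x) * x\<^sup>2 - ln (1 - x) * (2 * x)) / (x\<^sup>2 * x\<^sup>2)"
      unfolding h'_def using x by (auto intro!: derivative_eq_intros)
    also have "1 / (x * x) - (- 1 / (1 - x) * x\<^sup>2 - ln (1 - x) * (2 * x)) / (x\<^sup>2 * x\<^sup>2) = h'' x"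
      unfolding h''_def using x
      by (simp add: divide_simps power2_eq_square power3_eq_cube) (simp add: algebra_simps)
    finally show "DERIV h' x :> h'' x" .
    have "2 * ln (1 / (1 - x)) \<le> 1 / (1 - x) - 1 / (1 / (1 - x))"
      using x by (intro ln_sub_inverse_le) auto
    then have "0 \<le> (1 / (1 - x) - (1 - x) + 2 * ln (1 - x)) / x ^ 3"
      using x by (auto simp: ln_div)
    also have "\<dots> = h'' x"
      unfolding h''_def using x
      by (simp add: divide_simps power2_eq_square power3_eq_cube) (simp add: algebra_simps)
    finally show "0 \<le> h'' x" .
  qed (use s c in auto)
  have main: "1 - e * L + A * (s - ?c) \<le> h s" if "s \<in> {0<..<1}" for s
    using tan[OF that] unfolding hc h'c by simp
  consider "s = 0" | "0 < s" "s < 1" | "s = 1" using s by linarith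
  then show ?thesis
  proof cases
    case 2
    have "s * (1 - e * L + A * (s - ?c)) \<le> s * h s"
      using main[of s] 2 by (intro mult_left_mono) auto
    also have "\<dots> = (1 - s) * ln (1 - s) + s" using 2 by (simp add: h_def field_simps)
    finally show ?thesis .
  next
    case 3
    have "e * L \<le> 1"
      using ln_le_minus_one[of "(e + 1) / e"] e by (simp add: L_def field_simps)
    then have "e * (e * L) \<le> e * 1" using e by (intro mult_left_mono) auto
    moreover have "A * (1 - ?c) = e * ((e + 1) * L - 1)"
      using e by (simp add: A_def field_simps)
    ultimately show ?thesis using 3 by (simp add: algebra_simps)
  qed simp
qed

subsection \<open>Thinning of finitely supported laws\<close>

definition thin :: "nat \<Rightarrow> (nat \<Rightarrow> real) \<Rightarrow> real \<Rightarrow> nat \<Rightarrow> real" where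
  "thin N p l n = (\<Sum>k\<le>N. real (k choose n) * l ^ n * (1 - l) ^ (k - n) * p k)"

lemma thin_1: "n \<le> N \<Longrightarrow> thin N p 1 n = p n"
proof -
  assume "n \<le> N"
  have "thin N p 1 n = (\<Sum>k\<le>N. if k = n then p k else 0)"
    unfolding thin_def by (intro sum.cong refl) (auto simp: power_0_left not_less_eq_eq)
  then show ?thesis using \<open>n \<le> N\<close> by simp
qed

lemma thin_eq_0: "N < n \<Longrightarrow> thin N p l n = 0"
  unfolding thin_def by (intro sum.neutral) (auto simp: binomial_eq_0)

lemma sum_thin: "(\<Sum>n\<le>N. thin N p l n) = (\<Sum>k\<le>N. p k)"
proof -
  have "(\<Sum>n\<le>N. real (k choose n) * l ^ n * (1 - l) ^ (k - n)) = 1" if "k \<le> N" for k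
  proof -
    have "(\<Sum>n\<le>N. real (k choose n) * l ^ n * (1 - l) ^ (k - n))
        = (\<Sum>n\<le>k. real (k choose n) * l ^ n * (1 - l) ^ (k - n))"
      using that by (intro sum.mono_neutral_right) (auto simp: binomial_eq_0)
    also have "\<dots> = (l + (1 - l)) ^ k" by (rule binomial_ring[symmetric])
    finally show ?thesis by simp
  qed
  then show ?thesis
    unfolding thin_def by (subst sum.swap) (simp add: sum_distrib_right[symmetric])
qed

lemma thin_nonneg:
  assumes "\<And>k. k \<le> N \<Longrightarrow> 0 \<le> p k" "0 \<le> l" "l \<le> 1"
  shows "0 \<le> thin N p l n"
  unfolding thin_def using assms by (intro sum_nonneg) auto

text \<open>The term \<open>k = N\<close> alone is positive: thinning strictly between 0 and 1 fills
  all gaps below the largest point of the support.\<close>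

lemma thin_pos:
  assumes "\<And>k. k \<le> N \<Longrightarrow> 0 \<le> p k" "0 < p N" "0 < l" "l < 1" "n \<le> N"
  shows "0 < thin N p l n"
  unfolding thin_def using assms
  by (intro sum_pos2[of _ N] mult_pos_pos mult_nonneg_nonneg) auto

text \<open>The absorption identity turns the factor \<open>k - n\<close>, which comes from
  differentiating \<open>(1 - l) ^ (k - n)\<close>, into \<open>Suc n\<close> times the next
  binomial weight. This is the flow equation for a point mass at \<open>k\<close>.\<close>

lemma binomial_term_deriv:
  fixes l :: real
  assumes "l \<noteq> 0"
  shows "((\<lambda>l. real (k choose n) * l ^ n * (1 - l) ^ (k - n)) has_real_derivative
     (real n * (real (k choose n) * l ^ n * (1 - l) ^ (k - n))
       - real (Suc n) * (real (k choose Suc n) * l ^ Suc n * (1 - l) ^ (k - Suc n))) / l) (at l)"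
proof -
  have "Suc n * (k choose Suc n) = (k - n) * (k choose n)"
    by (simp only: binomial_absorption binomial_absorb_comp)
  then have absorb: "real (Suc n) * real (k choose Suc n) = real (k - n) * real (k choose n)"
    by (metis of_nat_mult)
  have "((\<lambda>l. real (k choose n) * l ^ n * (1 - l) ^ (k - n)) has_real_derivative
     real (k choose n) * (real n * l ^ (n - 1)) * (1 - l) ^ (k - n)
      - real (k choose n) * l ^ n * (real (k - n) * (1 - l) ^ (k - Suc n))) (at l)"
    by (auto intro!: derivative_eq_intros)
  also have "real n * l ^ (n - 1) = real n * l ^ n / l"
    using assms by (cases n) auto
  also have "real (k choose n) * l ^ n * (real (k - n) * (1 - l) ^ (k - Suc n))
      = (real (k - n) * real (k choose n)) * l ^ n * (1 - l) ^ (k - Suc n)"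
    by simp
  also have "\<dots> = real (Suc n) * (real (k choose Suc n) * l ^ Suc n * (1 - l) ^ (k - Suc n)) / l"
    unfolding absorb[symmetric] using assms by simp
  finally show ?thesis by (simp add: diff_divide_distrib mult_ac)
qed

lemma thin_deriv:
  assumes "l \<noteq> 0"
  shows "((\<lambda>l. thin N p l n) has_real_derivative
    (real n * thin N p l n - real (Suc n) * thin N p l (Suc n)) / l) (at l)"
proof -
  have "((\<lambda>l. thin N p l n) has_real_derivative
     (\<Sum>k\<le>N. (real n * (real (k choose n) * l ^ n * (1 - l) ^ (k - n))
       - real (Suc n) * (real (k choose Suc n) * l ^ Suc n * (1 - l) ^ (k - Suc n))) / l * p k)) (at l)"
    unfolding thin_def
    by (intro DERIV_sum DERIV_cmult_right binomial_term_deriv assms)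
  also have "(\<Sum>k\<le>N. (real n * (real (k choose n) * l ^ n * (1 - l) ^ (k - n))
       - real (Suc n) * (real (k choose Suc n) * l ^ Suc n * (1 - l) ^ (k - Suc n))) / l * p k)
     = (real n * thin N p l n - real (Suc n) * thin N p l (Suc n)) / l"
    unfolding thin_def
    by (simp add: sum_distrib_left sum_divide_distrib sum_subtractf[symmetric] algebra_simps
         diff_divide_distrib[symmetric] del: of_nat_Suc)
  finally show ?thesis .
qed

lemma thin_continuous_on: "continuous_on A (\<lambda>l. thin N p l n)"
  unfolding thin_def by (intro continuous_intros)

lemma binomial_term_Suc:
  fixes l :: real
  shows "real (Suc k choose Suc n) * l ^ Suc n * (1 - l) ^ (Suc k - Suc n)
   = l * (real (k choose n) * l ^ n * (1 - l) ^ (k - n))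
     + (1 - l) * (real (k choose Suc n) * l ^ Suc n * (1 - l) ^ (k - Suc n))"
proof (cases "n < k")
  case True
  then have "k - n = Suc (k - Suc n)" by simp
  then show ?thesis by (simp add: algebra_simps)
qed (auto simp: binomial_eq_0)

text \<open>The sum telescopes in \<open>M\<close> by the Pascal-type recursion
  \<open>binomial_term_Suc\<close>. The closed form shows that these partial sums are nonnegative,
  as summation by parts in \<open>thin_antimono\<close> requires.\<close>

lemma sum_binomial_term_diff:
  fixes l :: real
  shows "l * (\<Sum>k\<le>M. real (k choose n) * l ^ n * (1 - l) ^ (k - n)
      - real (k choose Suc n) * l ^ Suc n * (1 - l) ^ (k - Suc n))
   = real (Suc M choose Suc n) * l ^ Suc n * (1 - l) ^ (Suc M - Suc n)"
proof (induction M)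
  case 0
  then show ?case by (cases n) auto
next
  case (Suc M)
  show ?case
    unfolding sum.atMost_Suc distrib_left Suc.IH
    using binomial_term_Suc[of "Suc M" n l] by (simp only: algebra_simps)
qed

text \<open>Abel summation as an induction: the partial sum so far is nonnegative, so lowering its
  factor from \<open>p N\<close> to \<open>p (Suc N)\<close> cannot increase the product.\<close>

lemma sum_mult_antimono_ge:
  fixes c p :: "nat \<Rightarrow> real"
  assumes "\<And>M. M \<le> N \<Longrightarrow> 0 \<le> (\<Sum>k\<le>M. c k)" "\<And>n. n < N \<Longrightarrow> p (Suc n) \<le> p n"
  shows "p N * (\<Sum>k\<le>N. c k) \<le> (\<Sum>k\<le>N. c k * p k)"
  using assms
proof (induction N)
  case (Suc N)
  have "p (Suc N) * (\<Sum>k\<le>N. c k) \<le> p N * (\<Sum>k\<le>N. c k)"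
    using Suc.prems(1)[of N] Suc.prems(2)[of N] by (intro mult_right_mono) auto
  also have "\<dots> \<le> (\<Sum>k\<le>N. c k * p k)" using Suc by auto
  finally show ?case by (simp add: algebra_simps)
qed simp

text \<open>Since monotonicity survives thinning, a law need be rearranged only once and the
  estimates for nonincreasing laws then hold along its whole flow.\<close>

lemma thin_antimono:
  assumes "\<And>n. n < N \<Longrightarrow> p (Suc n) \<le> p n" "0 \<le> p N" "0 < l" "l \<le> 1"
  shows "thin N p l (Suc n) \<le> thin N p l n"
proof -
  let ?c = "\<lambda>k. real (k choose n) * l ^ n * (1 - l) ^ (k - n)
      - real (k choose Suc n) * l ^ Suc n * (1 - l) ^ (k - Suc n)"
  have c: "0 \<le> (\<Sum>k\<le>M. ?c k)" for M
  proof -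
    have "0 \<le> l * (\<Sum>k\<le>M. ?c k)"
      unfolding sum_binomial_term_diff using assms by simp
    then show ?thesis using assms(3) by (simp add: zero_le_mult_iff)
  qed
  have "0 \<le> p N * (\<Sum>k\<le>N. ?c k)" using c assms(2) by simp
  also have "\<dots> \<le> (\<Sum>k\<le>N. ?c k * p k)"
    using c assms(1) by (intro sum_mult_antimono_ge)
  also have "\<dots> = thin N p l n - thin N p l (Suc n)"
    unfolding thin_def sum_subtractf[symmetric] by (intro sum.cong refl) (simp only: left_diff_distrib)
  finally show ?thesis by simp
qed

subsection \<open>Rearrangement of the entropy rate\<close>

definition ent :: "nat \<Rightarrow> (nat \<Rightarrow> real) \<Rightarrow> real" where
  "ent N q = (\<Sum>n\<le>N. - (q n * ln (q n)))"

text \<open>The derivative of the entropy of \<open>thin N p l\<close> with respect to \<open>ln l\<close>.\<close>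

definition rate :: "nat \<Rightarrow> (nat \<Rightarrow> real) \<Rightarrow> real" where
  "rate N q = (\<Sum>n<N. real (Suc n) * (q (Suc n) * (ln (q n) - ln (q (Suc n)))))"

text \<open>The index \<open>c\<close> of the first entry and the value \<open>a\<close> preceding
  it are parameters, so that a list can be cut and its pieces shifted independently.\<close>

fun rate_list :: "real \<Rightarrow> real \<Rightarrow> real list \<Rightarrow> real" where
  "rate_list c a [] = 0"
| "rate_list c a (x # xs) = c * (x * (ln a - ln x)) + rate_list (c + 1) x xs"

lemma rate_list_append:
  "rate_list c a (xs @ ys) = rate_list c a xs + rate_list (c + real (length xs)) (last (a # xs)) ys"
  by (induction xs arbitrary: c a) (auto simp: algebra_simps)

lemma rate_list_conv_sum:
  "rate_list c a xs
     = (\<Sum>i<length xs. (c + real i) * (xs ! i * (ln ((a # xs) ! i) - ln (xs ! i))))"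
proof (induction xs arbitrary: c a)
  case (Cons x xs)
  show ?case
    by (simp add: Cons.IH sum.lessThan_Suc_shift add_ac del: sum.lessThan_Suc)
qed simp

text \<open>The predecessor \<open>a\<close> is arbitrary because the first entry carries the
  coefficient 0.\<close>

lemma rate_conv_list: "rate N q = rate_list 0 a (map q [0..<Suc N])"
proof -
  have "rate_list 0 a (map q [0..<Suc N])
      = (\<Sum>i<N. real (Suc i) * (map q [0..<Suc N] ! Suc i
           * (ln ((a # map q [0..<Suc N]) ! Suc i) - ln (map q [0..<Suc N] ! Suc i))))"
    unfolding rate_list_conv_sum by (simp add: sum.lessThan_Suc_shift del: sum.lessThan_Suc upt_Suc)
  also have "\<dots> = rate N q"
    unfolding rate_def by (intro sum.cong refl) (simp del: upt_Suc)
  finally show ?thesis ..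
qed

lemma mult_ln_diff_le:
  fixes x a :: real
  assumes "0 < x" "0 < a"
  shows "x * (ln a - ln x) \<le> a - x"
proof -
  have "x * ln (a / x) \<le> x * (a / x - 1)"
    using assms by (intro mult_left_mono ln_le_minus_one) auto
  also have "\<dots> = a - x" using assms by (simp add: field_simps)
  finally show ?thesis using assms by (simp add: ln_div)
qed

text \<open>The right-hand side is a right-endpoint Riemann sum of the increasing function \<open>exp\<close> along
  the logarithms of the list, hence at least the integral \<open>last (a # xs) - a\<close>.\<close>

lemma rate_list_step:
  assumes "0 < a" "\<forall>x\<in>set xs. 0 < x"
  shows "last (a # xs) - a \<le> rate_list c a xs - rate_list (c + 1) a xs"
  using assms
proof (induction xs arbitrary: a c)
  case (Cons x xs)
  have "x * (ln a - ln x) \<le> a - x" using Cons.prems by (intro mult_ln_diff_le) auto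
  moreover have "last (x # xs) - x \<le> rate_list (c + 1) x xs - rate_list (c + 1 + 1) x xs"
    using Cons.prems by (intro Cons.IH) auto
  ultimately show ?case by (simp add: algebra_simps)
qed simp

text \<open>With \<open>b\<close> the last entry of \<open>zs\<close>, \<open>l\<close> its length
  and \<open>D = ln b - ln m\<close>: shifting \<open>zs\<close> one place to the left gains at
  least \<open>b - m\<close> by \<open>rate_list_step\<close>, the new term of \<open>m\<close> is
  \<open>(i + l) * (m * D)\<close>, and giving \<open>ts\<close> the predecessor \<open>m\<close>
  instead of \<open>b\<close> costs at most \<open>(i + 1 + l) * (m * D)\<close>. The balance is
  nonnegative because \<open>m * D \<le> b - m\<close>. The case \<open>i = 0\<close> is the start
  of the list, where \<open>a\<close> is a dummy.\<close>

lemma rate_list_move: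
  assumes pos: "0 < m" "\<forall>x\<in>set zs. m \<le> x" "\<forall>x\<in>set ts. 0 < x \<and> x \<le> m"
    and i: "0 \<le> i" and a: "i = 0 \<or> m \<le> a"
  shows "rate_list i a (m # zs @ ts) \<le> rate_list i a (zs @ m # ts)"
proof (cases zs)
  case (Cons z zs')
  define l where "l = real (length zs)"
  define b where "b = last zs"
  have "b \<in> set zs" unfolding b_def using Cons by simp
  then have b: "m \<le> b" using pos by auto
  have z: "m \<le> z" using pos Cons by auto
  define D where "D = ln b - ln m"
  have D: "0 \<le> D" unfolding D_def using b pos by simp
  have lhs: "rate_list i a (m # zs @ ts)
     = i * (m * (ln a - ln m)) + rate_list (i + 1) m zs + rate_list (i + 1 + l) b ts"
    by (simp add: rate_list_append l_def b_def Cons add_ac)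
  have rhs: "rate_list i a (zs @ m # ts)
     = rate_list i a zs + (i + l) * (m * (ln b - ln m)) + rate_list (i + 1 + l) m ts"
    by (simp add: rate_list_append l_def b_def Cons algebra_simps)
  have 1: "rate_list i a zs = rate_list i m zs + i * (z * (ln a - ln m))"
    by (simp add: Cons algebra_simps)
  have 2: "b - m \<le> rate_list i m zs - rate_list (i + 1) m zs"
    using rate_list_step[of m zs i] pos unfolding b_def using Cons by fastforce
  have 3: "m * D \<le> b - m"
  unfolding D_def using b pos by (intro mult_ln_diff_le) auto
  have 4: "0 \<le> i * ((z - m) * (ln a - ln m))"
    using a z i pos by auto
  have 5: "rate_list (i + 1 + l) b ts - rate_list (i + 1 + l) m ts \<le> (i + 1 + l) * (m * D)"
  proof (cases ts)
    case Nil
    then show ?thesis using i pos D by (simp add: l_def)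
  next
    case (Cons t ts')
    have "rate_list (i + 1 + l) b ts - rate_list (i + 1 + l) m ts = (i + 1 + l) * (t * D)"
      by (simp add: Cons D_def algebra_simps)
    also have "\<dots> \<le> (i + 1 + l) * (m * D)"
      using i pos D Cons by (intro mult_left_mono mult_right_mono) (auto simp: l_def)
    finally show ?thesis .
  qed
  show ?thesis
    unfolding lhs rhs 1 using 2 3 4 5 unfolding D_def by (simp add: algebra_simps)
qed simp

text \<open>Selection sort: sorting by adjacent transpositions would not do, as they can decrease the rate.\<close>

lemma rate_list_sort:
  assumes "\<forall>x\<in>set xs. 0 < x" "\<forall>x\<in>set xs. \<forall>t\<in>set ts. 0 < t \<and> t \<le> x"
  shows "rate_list 0 a (xs @ ts) \<le> rate_list 0 a (rev (sort xs) @ ts)"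
  using assms
proof (induction "length xs" arbitrary: xs ts)
  case (Suc k)
  define m where "m = Min (set xs)"
  have ne: "set xs \<noteq> {}" using Suc.hyps(2) by auto
  have m: "m \<in> set xs" "\<And>x. x \<in> set xs \<Longrightarrow> m \<le> x"
    unfolding m_def using ne by (auto intro: Min_in)
  obtain ys zs where xs: "xs = ys @ m # zs" using split_list[OF m(1)] by auto
  have "0 < m" using m(1) Suc.prems by auto
  have "rate_list 0 a (xs @ ts)
      = rate_list 0 a ys + rate_list (real (length ys)) (last (a # ys)) (m # zs @ ts)"
    unfolding xs by (simp add: rate_list_append)
  also have "rate_list (real (length ys)) (last (a # ys)) (m # zs @ ts)
      \<le> rate_list (real (length ys)) (last (a # ys)) (zs @ m # ts)"
  proof (rule rate_list_move)
    show "real (length ys) = 0 \<or> m \<le> last (a # ys)"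
      using m(2) unfolding xs by (cases ys rule: rev_cases) auto
  qed (use \<open>0 < m\<close> m Suc.prems xs in auto)
  also have "rate_list 0 a ys + rate_list (real (length ys)) (last (a # ys)) (zs @ m # ts)
      = rate_list 0 a ((ys @ zs) @ m # ts)"
    by (simp add: rate_list_append[of _ _ ys])
  also have "\<dots> \<le> rate_list 0 a (rev (sort (ys @ zs)) @ m # ts)"
    using Suc.hyps(2) Suc.prems m \<open>0 < m\<close> unfolding xs by (intro Suc.hyps(1)) auto
  also have "rev (sort (ys @ zs)) @ m # ts = rev (sort xs) @ ts"
  proof -
    have "sort xs = m # sort (ys @ zs)"
      using m(2) unfolding xs by (intro properties_for_sort) auto
    then show ?thesis by simp
  qed
  finally show ?case by simp
qed simp

text \<open>Mass and entropy depend only on the multiset of values, so descending sorting preserves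
  them; the rate is handled by \<open>rate_list_sort\<close>.\<close>

lemma antimono_rearrangement:
  fixes q :: "nat \<Rightarrow> real"
  assumes "\<And>n. n \<le> N \<Longrightarrow> 0 < q n"
  obtains r where "\<And>n. n \<le> N \<Longrightarrow> 0 < r n" "\<And>n. n < N \<Longrightarrow> r (Suc n) \<le> r n"
    "(\<Sum>n\<le>N. r n) = (\<Sum>n\<le>N. q n)" "ent N r = ent N q" "rate N q \<le> rate N r"
proof -
  define xs where "xs = map q [0..<Suc N]"
  define ys where "ys = rev (sort xs)"
  define r where "r = (\<lambda>n. ys ! n)"
  have len: "length ys = Suc N" unfolding ys_def xs_def by simp
  have ys: "map r [0..<Suc N] = ys"
    unfolding r_def using len by (metis map_nth)
  have sumf: "(\<Sum>n\<le>N. f (r n)) = (\<Sum>n\<le>N. f (q n))" for f :: "real \<Rightarrow> real"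
  proof -
    have *: "(\<Sum>n\<le>N. f (s n)) = sum_mset (image_mset f (mset (map s [0..<Suc N])))"
      for s :: "nat \<Rightarrow> real"
    proof -
      have "(\<Sum>n\<le>N. f (s n)) = sum_list (map f (map s [0..<Suc N]))"
        by (simp add: sum_list_distinct_conv_sum_set atLeast0LessThan lessThan_Suc_atMost o_def del: upt_Suc)
      then show ?thesis by (metis mset_map sum_mset_sum_list)
    qed
    have "mset ys = mset xs" unfolding ys_def by simp
    then show ?thesis unfolding * ys xs_def by simp
  qed
  have set: "set ys = q ` {..N}"
    unfolding ys_def xs_def by (simp add: atLeast0LessThan lessThan_Suc_atMost del: upt_Suc)
  show ?thesis
  proof (rule that[of r])
    show "0 < r n" if "n \<le> N" for n
    proof -
      have "r n \<in> set ys" unfolding r_def using that len by simp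
      then show ?thesis unfolding set using assms by auto
    qed
    show "r (Suc n) \<le> r n" if "n < N" for n
    proof -
      have "sorted (rev ys)" unfolding ys_def by simp
      then show ?thesis unfolding r_def using that len 
        by (simp add: sorted_rev_iff_nth_Suc)
    qed
    show "(\<Sum>n\<le>N. r n) = (\<Sum>n\<le>N. q n)" by (rule sumf)
    show "ent N r = ent N q" unfolding ent_def by (rule sumf)
    have "rate_list 0 1 (xs @ []) \<le> rate_list 0 1 (rev (sort xs) @ [])"
      using assms by (intro rate_list_sort) (auto simp: xs_def)
    then show "rate N q \<le> rate N r"
      unfolding rate_conv_list[of _ _ 1] ys unfolding xs_def ys_def by (simp del: upt_Suc)
  qed
qed

subsection \<open>Evolution of the entropy rate\<close>

lemma sum_number_flow:
  fixes q :: "nat \<Rightarrow> real"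
  shows "(\<Sum>n\<le>N. real n * q n - real (Suc n) * q (Suc n)) = - (real (Suc N) * q (Suc N))"
  by (induction N) (auto simp: algebra_simps)

text \<open>With mass 1 and \<open>q (Suc N) = 0\<close>, the weights
  \<open>real (Suc n) * (q n - q (Suc n))\<close> sum to 1; for nonincreasing \<open>q\<close> they
  are its coefficients as a mixture of uniform laws on \<open>{0..n}\<close>.\<close>

lemma sum_Suc_mult_diff:
  fixes q :: "nat \<Rightarrow> real"
  shows "(\<Sum>n\<le>N. real (Suc n) * (q n - q (Suc n))) = (\<Sum>n\<le>N. q n) - real (Suc N) * q (Suc N)"
  by (induction N) (auto simp: algebra_simps)

text \<open>The three telescoping quantities come from shifting summation indices; the only estimate is
  \<open>ln u \<le> u - 1\<close> at \<open>u = q n ^ 2 / (q (n - 1) * q (n + 1))\<close>.\<close>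

lemma rate_deriv_le:
  fixes q :: "nat \<Rightarrow> real"
  assumes pos: "\<And>n. n \<le> N \<Longrightarrow> 0 < q n" and z: "q (Suc N) = 0" and s: "(\<Sum>n\<le>N. q n) = 1"
  defines "d \<equiv> \<lambda>n. real n * q n - real (Suc n) * q (Suc n)"
  shows "(\<Sum>n<N. real (Suc n) * (d (Suc n) * (ln (q n) - ln (q (Suc n)))
             + q (Suc n) * (d n / q n - d (Suc n) / q (Suc n))))
     \<le> rate N q - 1 + (\<Sum>n\<le>N. real (Suc n) * ((q n - q (Suc n))\<^sup>2 / q n))"
proof -
  define Lp where "Lp = (\<lambda>n. ln (q (n - 1)) - ln (q n))"
  define G where "G = (\<lambda>n. real n * real (Suc n) * q (Suc n) * Lp n)"
  define K where "K = (\<lambda>n. real n * real (Suc n) * ((q n)\<^sup>2 / q (n - 1)))"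
  define M where "M = (\<lambda>n. real n * real (Suc n) * q (Suc n))"
  have summand: "real (Suc n) * (d (Suc n) * (ln (q n) - ln (q (Suc n)))
             + q (Suc n) * (d n / q n - d (Suc n) / q (Suc n)))
     \<le> real (Suc n) * (q (Suc n) * (ln (q n) - ln (q (Suc n))))
        - real (Suc n) * q (Suc n) + real (Suc n) * ((q (Suc n))\<^sup>2 / q n)
        + ((M (Suc n) - G (Suc n) - K (Suc n)) - (M n - G n - K n))" if n: "n < N" for n
  proof -
    have p: "0 < q n" "0 < q (Suc n)" using pos n by auto
    let ?l = "ln (q n) - ln (q (Suc n))"
    have e1: "real (Suc n) * (q (Suc n) * (d n / q n - d (Suc n) / q (Suc n)))
        = M n - real (Suc n) * real (Suc n) * ((q (Suc n))\<^sup>2 / q n)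
          - real (Suc n) * real (Suc n) * q (Suc n) + M (Suc n)"
      using p unfolding d_def M_def by (simp add: field_simps power2_eq_square)
    have e2: "real (Suc n) * (d (Suc n) * ?l)
        = real (Suc n) * (q (Suc n) * ?l) + real n * real (Suc n) * q (Suc n) * ?l - G (Suc n)"
      unfolding d_def G_def Lp_def by (simp add: algebra_simps)
    have e3: "real n * real (Suc n) * q (Suc n) * ?l \<le> G n + K n - M n"
    proof (cases n)
      case 0
      then show ?thesis by (simp add: G_def K_def M_def)
    next
      case (Suc k)
      have pk: "0 < q k" using pos n Suc by simp
      have "ln ((q n)\<^sup>2 / (q k * q (Suc n))) \<le> (q n)\<^sup>2 / (q k * q (Suc n)) - 1"
        using p pk by (intro ln_le_minus_one) auto
      also have "ln ((q n)\<^sup>2 / (q k * q (Suc n))) = ?l - Lp n"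
        using p pk unfolding Lp_def Suc by (simp add: ln_div ln_mult power2_eq_square)
      finally have "q (Suc n) * (?l - Lp n) \<le> q (Suc n) * ((q n)\<^sup>2 / (q k * q (Suc n)) - 1)"
        using p by (intro mult_left_mono) auto
      also have "\<dots> = (q n)\<^sup>2 / q k - q (Suc n)" using p pk by (simp add: field_simps)
      finally have "real n * real (Suc n) * (q (Suc n) * (?l - Lp n))
          \<le> real n * real (Suc n) * ((q n)\<^sup>2 / q k - q (Suc n))"
        by (intro mult_left_mono) auto
      then show ?thesis unfolding G_def K_def M_def by (simp add: Suc algebra_simps)
    qed
    have e4: "K (Suc n) = real (Suc n) * real (Suc n) * ((q (Suc n))\<^sup>2 / q n)
        + real (Suc n) * ((q (Suc n))\<^sup>2 / q n)"
    proof -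
      have "a * (a + 1) * Q = a * a * Q + a * Q" for a Q :: real by (simp add: algebra_simps)
      moreover have "real (Suc (Suc n)) = real (Suc n) + 1" by simp
      ultimately show ?thesis unfolding K_def diff_Suc_1 by (simp only:)
    qed
    have e5: "M n + real (Suc n) * q (Suc n) = real (Suc n) * real (Suc n) * q (Suc n)"
      unfolding M_def by (simp add: algebra_simps)
    have arith: "b + a \<le> T - Q + R + ((M' - G' - K') - (m - g - k))"
      if "a = m - S - P + M'" "b = T + U - G'" "U \<le> g + k - m" "K' = S + R" "m + Q = P"
      for a b m S P M' T U G' g k K' R Q :: real
      using that by linarith
    show ?thesis unfolding distrib_left[of "real (Suc n)"] by (rule arith[OF e1 e2 e3 e4 e5])
  qed
  have "(\<Sum>n<N. real (Suc n) * (d (Suc n) * (ln (q n) - ln (q (Suc n)))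
             + q (Suc n) * (d n / q n - d (Suc n) / q (Suc n))))
     \<le> (\<Sum>n<N. real (Suc n) * (q (Suc n) * (ln (q n) - ln (q (Suc n))))
        - real (Suc n) * q (Suc n) + real (Suc n) * ((q (Suc n))\<^sup>2 / q n)
        + ((M (Suc n) - G (Suc n) - K (Suc n)) - (M n - G n - K n)))"
    by (intro sum_mono summand) auto
  also have "\<dots> = rate N q - (\<Sum>n<N. real (Suc n) * q (Suc n))
      + (\<Sum>n<N. real (Suc n) * ((q (Suc n))\<^sup>2 / q n)) + (M N - G N - K N) - (M 0 - G 0 - K 0)"
    using sum_lessThan_telescope[of "\<lambda>n. M n - G n - K n" N]
    unfolding rate_def sum.distrib by (simp add: sum_subtractf del: of_nat_Suc)
  \<comment> \<open>As \<open>q (Suc N) = 0\<close>, only \<open>- K N\<close> can survive at the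
    upper end, and its sign is favourable.\<close>
  also have "M N - G N - K N \<le> 0"
    unfolding M_def G_def K_def z using pos[of N] pos[of "N - 1"] by simp
  also have "M 0 - G 0 - K 0 = 0" by (simp add: M_def G_def K_def)
  also have "rate N q - (\<Sum>n<N. real (Suc n) * q (Suc n))
      + (\<Sum>n<N. real (Suc n) * ((q (Suc n))\<^sup>2 / q n)) + 0 - 0
     = rate N q - 1 + (\<Sum>n\<le>N. real (Suc n) * ((q n - q (Suc n))\<^sup>2 / q n))"
  proof -
    \<comment> \<open>Expanding one factor of the square leaves the probability weights, which sum
      to 1, and two sums already present.\<close>
    have "(\<Sum>n\<le>N. real (Suc n) * ((q n - q (Suc n))\<^sup>2 / q n))
      = (\<Sum>n\<le>N. real (Suc n) * (q n - q (Suc n)) - real (Suc n) * q (Suc n)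
          + real (Suc n) * ((q (Suc n))\<^sup>2 / q n))"
    proof (intro sum.cong refl)
      fix n assume "n \<in> {..N}"
      then have "q n \<noteq> 0" using pos[of n] by auto
      then show "real (Suc n) * ((q n - q (Suc n))\<^sup>2 / q n)
        = real (Suc n) * (q n - q (Suc n)) - real (Suc n) * q (Suc n)
          + real (Suc n) * ((q (Suc n))\<^sup>2 / q n)"
        by (simp add: field_simps power2_eq_square)
    qed
    also have "\<dots> = 1 - (\<Sum>n\<le>N. real (Suc n) * q (Suc n))
       + (\<Sum>n\<le>N. real (Suc n) * ((q (Suc n))\<^sup>2 / q n))"
      by (simp add: sum.distrib sum_subtractf sum_Suc_mult_diff[unfolded of_nat_Suc] z s)
    also have "\<dots> = 1 - (\<Sum>n<N. real (Suc n) * q (Suc n))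
       + (\<Sum>n<N. real (Suc n) * ((q (Suc n))\<^sup>2 / q n))"
      by (simp add: z lessThan_Suc_atMost[symmetric])
    finally show ?thesis by simp
  qed
  finally show ?thesis by simp
qed

text \<open>Jensen's inequality in tangent form: \<open>entropy_defect_tangent\<close> is averaged
  at \<open>s = (q n - q (Suc n)) / q n\<close>. The tangent point \<open>1 / (e + 1)\<close> is the
  constant value of \<open>s\<close> for the geometric law of mean \<open>e\<close>.\<close>

lemma rate_dispersion_bound:
  fixes q :: "nat \<Rightarrow> real"
  assumes pos: "\<And>n. n \<le> N \<Longrightarrow> 0 < q n" and dec: "\<And>n. n < N \<Longrightarrow> q (Suc n) \<le> q n"
    and z: "q (Suc N) = 0" and s: "(\<Sum>n\<le>N. q n) = 1" and e: "0 < e"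
  defines "L \<equiv> ln ((e + 1) / e)"
  defines "A \<equiv> (e + 1) * ((e + 1) * L - 1)"
  shows "1 - e * L - A / (e + 1) + A * (\<Sum>n\<le>N. real (Suc n) * ((q n - q (Suc n))\<^sup>2 / q n))
       \<le> 1 - rate N q"
proof -
  define B where "B = 1 - e * L - A / (e + 1)"
  have summand: "real (Suc n) * (q n - q (Suc n)) * B + A * (real (Suc n) * ((q n - q (Suc n))\<^sup>2 / q n))
      \<le> real (Suc n) * (q n - q (Suc n)) - real (Suc n) * (q (Suc n) * (ln (q n) - ln (q (Suc n))))"
    if n: "n \<le> N" for n
  proof -
    define t where "t = (q n - q (Suc n)) / q n"
    have qn: "0 < q n" using pos n by auto
    have q': "0 \<le> q (Suc n)" "q (Suc n) \<le> q n"
      using pos[of "Suc n"] dec[of n] z qn n by (cases "n = N"; auto)+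
    have t: "0 \<le> t" "t \<le> 1" using qn q' by (auto simp: t_def)
    have qt: "q n * t = q n - q (Suc n)" and q1t: "q n * (1 - t) = q (Suc n)"
      using qn by (auto simp: t_def field_simps)
    have "t * (1 - e * L + A * (t - 1 / (e + 1))) \<le> (1 - t) * ln (1 - t) + t"
      unfolding L_def A_def by (rule entropy_defect_tangent[OF e t])
    then have "q n * (t * (1 - e * L + A * (t - 1 / (e + 1)))) \<le> q n * ((1 - t) * ln (1 - t) + t)"
      using qn by (intro mult_left_mono) auto
    moreover have "q n * (t * (1 - e * L + A * (t - 1 / (e + 1))))
        = (q n * t) * B + A * ((q n * t)\<^sup>2 / q n)"
      using qn by (simp add: B_def field_simps power2_eq_square)
    moreover have "q n * ((1 - t) * ln (1 - t) + t) = (q n * (1 - t)) * ln (1 - t) + q n * t"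
      by (simp add: algebra_simps)
    moreover have "(q n * (1 - t)) * ln (1 - t) = - (q (Suc n) * (ln (q n) - ln (q (Suc n))))"
    proof (cases "q (Suc n) = 0")
      case False
      have "1 - t = q (Suc n) / q n" using qn by (simp add: t_def field_simps)
      then have lnt: "ln (1 - t) = - (ln (q n) - ln (q (Suc n)))"
        using False q' qn by (simp add: ln_div)
      show ?thesis unfolding q1t lnt by (rule mult_minus_right)
    qed (simp add: q1t)
    ultimately have "(q n - q (Suc n)) * B + A * ((q n - q (Suc n))\<^sup>2 / q n)
       \<le> (q n - q (Suc n)) - q (Suc n) * (ln (q n) - ln (q (Suc n)))"
      unfolding qt by simp
    then have "real (Suc n) * ((q n - q (Suc n)) * B + A * ((q n - q (Suc n))\<^sup>2 / q n))
       \<le> real (Suc n) * ((q n - q (Suc n)) - q (Suc n) * (ln (q n) - ln (q (Suc n))))"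
      by (intro mult_left_mono) auto
    then show ?thesis by (simp only: algebra_simps)
  qed
  have one: "(\<Sum>n\<le>N. real (Suc n) * (q n - q (Suc n))) = 1"
    unfolding sum_Suc_mult_diff z s by simp
  have "B + A * (\<Sum>n\<le>N. real (Suc n) * ((q n - q (Suc n))\<^sup>2 / q n))
     = (\<Sum>n\<le>N. real (Suc n) * (q n - q (Suc n)) * B + A * (real (Suc n) * ((q n - q (Suc n))\<^sup>2 / q n)))"
    unfolding sum.distrib sum_distrib_right[symmetric] sum_distrib_left[symmetric] one by simp
  also have "\<dots> \<le> (\<Sum>n\<le>N. real (Suc n) * (q n - q (Suc n))
      - real (Suc n) * (q (Suc n) * (ln (q n) - ln (q (Suc n)))))"
    by (intro sum_mono summand) auto
  also have "\<dots> = 1 - (\<Sum>n\<le>N. real (Suc n) * (q (Suc n) * (ln (q n) - ln (q (Suc n)))))"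
    unfolding sum_subtractf one ..
  also have "\<dots> = 1 - rate N q"
    by (simp add: rate_def z lessThan_Suc_atMost[symmetric])
  finally show ?thesis unfolding B_def .
qed

section \<open>Rate and entropy of the geometric flow\<close>

text \<open>The derivative of \<open>g_real E\<close> with respect to \<open>ln E\<close>.\<close>

definition geometric_rate :: "real \<Rightarrow> real" where
  "geometric_rate E = E * (ln (E + 1) - ln E)"

text \<open>This is \<open>ln x < x - 1\<close> at \<open>x = E / (E + 1)\<close>. The gap between
  the two sides is \<open>E\<close> times the derivative of \<open>geometric_rate\<close>, so it
  yields strict monotonicity.\<close>

lemma geometric_rate_gt:
  assumes "0 < E"
  shows "E / (E + 1) < geometric_rate E"
proof -
  let ?x = "E / (E + 1)"
  have "ln ?x \<noteq> ?x - 1" using assms ln_eq_minus_one[of ?x] by auto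
  then have "ln ?x < ?x - 1" using assms ln_le_minus_one[of ?x] by simp
  also have "?x - 1 = - 1 / (E + 1)" using assms by (simp add: field_simps)
  finally have "1 / (E + 1) < ln (E + 1) - ln E" using assms by (simp add: ln_div)
  then have "E * (1 / (E + 1)) < E * (ln (E + 1) - ln E)"
    using assms by (intro mult_strict_left_mono)
  then show ?thesis by (simp add: geometric_rate_def)
qed

lemma geometric_rate_scaled_deriv:
  assumes "0 < E" "0 < l"
  shows "((\<lambda>l. geometric_rate (l * E)) has_real_derivative
     (geometric_rate (l * E) - l * E / (l * E + 1)) / l) (at l)"
proof -
  have pos: "0 < l * E" "0 < l * E + 1" using assms by (auto intro: add_pos_pos)
  have "((\<lambda>l. geometric_rate (l * E)) has_real_derivative
     E * (ln (l * E + 1) - ln (l * E)) + l * E * (E / (l * E + 1) - E / (l * E))) (at l)"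
    unfolding geometric_rate_def using pos by (auto intro!: derivative_eq_intros)
  also have "E * (ln (l * E + 1) - ln (l * E)) + l * E * (E / (l * E + 1) - E / (l * E))
     = (geometric_rate (l * E) - l * E / (l * E + 1)) / l"
    unfolding geometric_rate_def using assms pos
    by (simp add: divide_simps) (simp add: algebra_simps)
  finally show ?thesis .
qed

lemma geometric_rate_strict_mono:
  assumes "0 < a" "a < b"
  shows "geometric_rate a < geometric_rate b"
proof (rule DERIV_pos_imp_increasing[OF assms(2)])
  fix x assume x: "a \<le> x" "x \<le> b"
  have "((\<lambda>l. geometric_rate (l * 1)) has_real_derivative
      (geometric_rate (x * 1) - x * 1 / (x * 1 + 1)) / x) (at x)"
    using x assms by (intro geometric_rate_scaled_deriv) auto
  moreover have "0 < (geometric_rate x - x / (x + 1)) / x"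
    using geometric_rate_gt[of x] x assms by simp
  ultimately show "\<exists>y. DERIV geometric_rate x :> y \<and> 0 < y" by auto
qed

lemma g_real_scaled_deriv:
  assumes "0 < E" "0 < l"
  shows "((\<lambda>l. g_real (l * E)) has_real_derivative geometric_rate (l * E) / l) (at l)"
proof -
  have pos: "0 < l * E" "0 < l * E + 1" using assms by (auto intro: add_pos_pos)
  have "((\<lambda>l. g_real (l * E)) has_real_derivative
     (E * ln (l * E + 1) + (l * E + 1) * (E / (l * E + 1)))
       - (E * ln (l * E) + l * E * (E / (l * E)))) (at l)"
    unfolding g_real_def using pos by (auto intro!: derivative_eq_intros)
  also have "(E * ln (l * E + 1) + (l * E + 1) * (E / (l * E + 1)))
       - (E * ln (l * E) + l * E * (E / (l * E))) = geometric_rate (l * E) / l"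
    unfolding geometric_rate_def using assms pos
    by (simp add: divide_simps) (simp add: algebra_simps)
  finally show ?thesis .
qed

section \<open>Entropy and its rate along the thinning flow\<close>

lemma x_ln_x_continuous_on: "continuous_on {0..} (\<lambda>x::real. x * ln x)"
proof -
  have "continuous_on {0..} (\<lambda>x::real. (x + 1) * ln (x + 1) - g_real x)"
    by (intro continuous_on_diff g_real_continuous_on) (auto intro!: continuous_intros)
  then show ?thesis by (simp add: g_real_def)
qed

lemma ent_term_nonneg:
  fixes x :: real
  assumes "0 \<le> x" "x \<le> 1"
  shows "0 \<le> - (x * ln x)"
  using assms by (cases "x = 0") (auto simp: mult_le_0_iff)

lemma prob_le_1:
  fixes q :: "nat \<Rightarrow> real"
  assumes "\<And>n. n \<le> N \<Longrightarrow> 0 \<le> q n" "(\<Sum>n\<le>N. q n) = 1" "n \<le> N"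
  shows "q n \<le> 1"
  using member_le_sum[of n "{..N}" q] assms by auto

lemma ent_nonneg:
  assumes "\<And>n. n \<le> N \<Longrightarrow> 0 \<le> q n" "(\<Sum>n\<le>N. q n) = 1"
  shows "0 \<le> ent N q"
  unfolding ent_def using assms prob_le_1[of N q] by (intro sum_nonneg ent_term_nonneg) auto

lemma ent_pos:
  assumes pos: "\<And>n. n \<le> N \<Longrightarrow> 0 < q n" and s: "(\<Sum>n\<le>N. q n) = 1" and "0 < N"
  shows "0 < ent N q"
proof -
  have "q 0 + q N = (\<Sum>n\<in>{0,N}. q n)" using \<open>0 < N\<close> by simp
  also have "\<dots> \<le> (\<Sum>n\<le>N. q n)" using pos by (intro sum_mono2) (auto intro: less_imp_le)
  finally have "q 0 < 1" using pos[of N] s by simp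
  then have "0 < - (q 0 * ln (q 0))" using pos[of 0] by (simp add: mult_less_0_iff)
  then show ?thesis unfolding ent_def
    using pos prob_le_1[of N q] s
    by (intro sum_pos2[of _ 0] ent_term_nonneg) (auto intro: less_imp_le)
qed

lemma ent_thin_deriv:
  assumes "0 < l" and pos: "\<And>n. n \<le> N \<Longrightarrow> 0 < thin N p l n"
  shows "((\<lambda>l. ent N (thin N p l)) has_real_derivative rate N (thin N p l) / l) (at l)"
proof -
  define q where "q = thin N p l"
  define d where "d = (\<lambda>n. real n * q n - real (Suc n) * q (Suc n))"
  have qd: "((\<lambda>l. thin N p l n) has_real_derivative d n / l) (at l)" for n
    unfolding d_def q_def using assms by (intro thin_deriv) auto
  have z: "q (Suc N) = 0" unfolding q_def by (simp add: thin_eq_0)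
  have "((\<lambda>l. - (thin N p l n * ln (thin N p l n))) has_real_derivative
      - (d n / l * ln (q n) + d n / l)) (at l)" if "n \<le> N" for n
  proof -
    have "((\<lambda>l. - (thin N p l n * ln (thin N p l n))) has_real_derivative
      - (d n / l * ln (q n) + (d n / l) / q n * q n)) (at l)"
      unfolding q_def using pos[OF that]
      by (auto intro!: derivative_eq_intros qd simp: q_def)
    then show ?thesis using pos[OF that] by (simp add: q_def)
  qed
  then have "((\<lambda>l. ent N (thin N p l)) has_real_derivative
      (\<Sum>n\<le>N. - (d n / l * ln (q n) + d n / l))) (at l)"
    unfolding ent_def by (intro DERIV_sum) auto
  also have "(\<Sum>n\<le>N. - (d n / l * ln (q n) + d n / l)) = - (\<Sum>n\<le>N. d n * ln (q n)) / l - (\<Sum>n\<le>N. d n) / l"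
    by (simp add: sum_negf sum.distrib sum_subtractf sum_divide_distrib)
  \<comment> \<open>Conservation of mass removes the constant in the derivative
    \<open>ln x + 1\<close> of \<open>x * ln x\<close>.\<close>
  also have "(\<Sum>n\<le>N. d n) = 0"
    unfolding d_def sum_number_flow z by simp
  also have "- (\<Sum>n\<le>N. d n * ln (q n)) = rate N q"
  proof -
    \<comment> \<open>Summation by parts for every cutoff \<open>M\<close>; the boundary term
      vanishes at \<open>M = N\<close>.\<close>
    have "(\<Sum>n\<le>M. d n * ln (q n)) = - rate M q - real (Suc M) * q (Suc M) * ln (q M)" for M
      by (induction M) (auto simp: rate_def d_def algebra_simps)
    then show ?thesis by (simp add: z)
  qed
  finally show ?thesis by (simp add: q_def)
qed

lemma rate_thin_deriv:
  assumes "0 < l" and pos: "\<And>n. n \<le> N \<Longrightarrow> 0 < thin N p l n"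
  defines "q \<equiv> thin N p l"
  defines "d \<equiv> \<lambda>n. real n * q n - real (Suc n) * q (Suc n)"
  shows "((\<lambda>l. rate N (thin N p l)) has_real_derivative
    (\<Sum>n<N. real (Suc n) * (d (Suc n) * (ln (q n) - ln (q (Suc n)))
             + q (Suc n) * (d n / q n - d (Suc n) / q (Suc n)))) / l) (at l)"
proof -
  have qd: "((\<lambda>l. thin N p l n) has_real_derivative d n / l) (at l)" for n
    unfolding d_def q_def using assms by (intro thin_deriv) auto
  have "((\<lambda>l. real (Suc n) * (thin N p l (Suc n) * (ln (thin N p l n) - ln (thin N p l (Suc n)))))
     has_real_derivative real (Suc n) * (d (Suc n) / l * (ln (q n) - ln (q (Suc n)))
             + (d n / l / q n - d (Suc n) / l / q (Suc n)) * q (Suc n))) (at l)" if "n < N" for n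
    using pos[of n] pos[of "Suc n"] that
    by (auto intro!: derivative_eq_intros qd simp: q_def mult.commute)
  then have "((\<lambda>l. rate N (thin N p l)) has_real_derivative
    (\<Sum>n<N. real (Suc n) * (d (Suc n) / l * (ln (q n) - ln (q (Suc n)))
             + (d n / l / q n - d (Suc n) / l / q (Suc n)) * q (Suc n)))) (at l)"
    unfolding rate_def by (intro DERIV_sum) auto
  also have "(\<Sum>n<N. real (Suc n) * (d (Suc n) / l * (ln (q n) - ln (q (Suc n)))
             + (d n / l / q n - d (Suc n) / l / q (Suc n)) * q (Suc n)))
     = (\<Sum>n<N. real (Suc n) * (d (Suc n) * (ln (q n) - ln (q (Suc n)))
             + q (Suc n) * (d n / q n - d (Suc n) / q (Suc n)))) / l"
    unfolding sum_divide_distrib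
  proof (intro sum.cong refl)
    fix n
    have "r * (a / l * L + (b / l / x - a / l / y) * y) = r * (a * L + y * (b / x - a / y)) / l"
      for r a b L x y :: real
      using \<open>0 < l\<close> by (simp add: field_simps)
    then show "real (Suc n) * (d (Suc n) / l * (ln (q n) - ln (q (Suc n)))
             + (d n / l / q n - d (Suc n) / l / q (Suc n)) * q (Suc n))
      = real (Suc n) * (d (Suc n) * (ln (q n) - ln (q (Suc n)))
             + q (Suc n) * (d n / q n - d (Suc n) / q (Suc n))) / l" .
  qed
  finally show ?thesis .
qed

subsection \<open>Comparison with geometric laws\<close>

lemma thin_pos_of_pos:
  assumes "\<And>n. n \<le> N \<Longrightarrow> 0 < p n" "0 < l" "l \<le> 1" "n \<le> N"
  shows "0 < thin N p l n"
  using assms by (cases "l = 1") (auto simp: thin_1 intro!: thin_pos less_imp_le)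

text \<open>With \<open>q = thin N p l\<close>, \<open>e = l E\<close> and \<open>\<delta> = rate N q - geometric_rate e\<close>, the bounds above
  give \<open>l \<delta>' \<le> \<delta> (1 - 1 / A)\<close>, and the denominator \<open>w\<close> below solves \<open>l w' = w (1 - 1 / A)\<close>: it is
  the variation of \<open>geometric_rate (l E)\<close> with respect to \<open>E\<close>.\<close>

lemma rate_defect_ratio_antimono:
  assumes pos: "\<And>n. n \<le> N \<Longrightarrow> 0 < p n" and dec: "\<And>n. n < N \<Longrightarrow> p (Suc n) \<le> p n"
    and s: "(\<Sum>n\<le>N. p n) = 1" and E: "0 < E" and ab: "0 < a" "a \<le> b" "b \<le> 1"
  defines "f \<equiv> \<lambda>l. (rate N (thin N p l) - geometric_rate (l * E))
                  / (geometric_rate (l * E) - l * E / (l * E + 1))"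
  shows "f b \<le> f a"
proof (rule DERIV_nonpos_imp_nonincreasing[OF ab(2)])
  fix l assume l: "a \<le> l" "l \<le> b"
  then have l0: "0 < l" and l1: "l \<le> 1" using ab by auto
  define q where "q = thin N p l"
  define d where "d = (\<lambda>n. real n * q n - real (Suc n) * q (Suc n))"
  define e where "e = l * E"
  define R where "R = (\<Sum>n<N. real (Suc n) * (d (Suc n) * (ln (q n) - ln (q (Suc n)))
             + q (Suc n) * (d n / q n - d (Suc n) / q (Suc n))))"
  define Y where "Y = (\<Sum>n\<le>N. real (Suc n) * ((q n - q (Suc n))\<^sup>2 / q n))"
  define D where "D = rate N q - geometric_rate e"
  define w where "w = geometric_rate e - e / (e + 1)"
  define A where "A = (e + 1) * ((e + 1) * ln ((e + 1) / e) - 1)"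
  have e: "0 < e" using l0 E by (simp add: e_def)
  have qpos: "0 < thin N p l n" if "n \<le> N" for n
    by (rule thin_pos_of_pos) (use pos l0 l1 that in auto)
  have qz: "q (Suc N) = 0" unfolding q_def by (simp add: thin_eq_0)
  have qs: "(\<Sum>n\<le>N. q n) = 1" unfolding q_def sum_thin s ..
  have qdec: "q (Suc n) \<le> q n" for n
    unfolding q_def using dec pos[of N] l0 l1 by (intro thin_antimono) auto
  have w0: "0 < w" unfolding w_def using geometric_rate_gt[OF e] by simp
  have R: "R \<le> rate N q - 1 + Y"
    unfolding R_def Y_def d_def using qpos qz qs by (intro rate_deriv_le) (auto simp: q_def)
  have "1 - e * ln ((e + 1) / e) - A / (e + 1) + A * Y \<le> 1 - rate N q"
    unfolding A_def Y_def using qpos qz qs qdec e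
    by (intro rate_dispersion_bound) (auto simp: q_def)
  moreover have "e * ln ((e + 1) / e) = geometric_rate e"
    using e by (simp add: geometric_rate_def ln_div)
  ultimately have AY: "A * (Y - 1 / (e + 1)) \<le> - D"
    by (simp add: D_def algebra_simps)
  \<comment> \<open>The factor \<open>e / (e + 1)\<^sup>2\<close> is \<open>l\<close> times the
    derivative of \<open>l * E / (l * E + 1)\<close> in \<open>l\<close>. It therefore equals
    \<open>w / A\<close>, which is why \<open>l w'\<close> is
    \<open>w * (1 - 1 / A)\<close>.\<close>
  have Aw: "A * (e / (e + 1)\<^sup>2) = w"
  proof -
    have "s * (s * T - 1) * (e / s\<^sup>2) = e * T - e / s" if "s \<noteq> 0" for s T :: real
      using that by (simp add: divide_simps power2_eq_square) (simp add: algebra_simps)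
    then show ?thesis
      unfolding A_def w_def geometric_rate_def using e by (simp add: ln_div)
  qed
  have "(A * (Y - 1 / (e + 1))) * (e / (e + 1)\<^sup>2) \<le> (- D) * (e / (e + 1)\<^sup>2)"
    using AY e by (intro mult_right_mono) auto
  then have key: "w * (Y - 1 / (e + 1)) \<le> - D * (e / (e + 1)\<^sup>2)"
    unfolding Aw[symmetric] by (simp add: mult_ac)
  have D': "((\<lambda>l. rate N (thin N p l) - geometric_rate (l * E)) has_real_derivative (R - w) / l) (at l)"
    unfolding diff_divide_distrib
  proof (rule DERIV_diff)
    show "((\<lambda>l. rate N (thin N p l)) has_real_derivative R / l) (at l)"
      unfolding R_def d_def q_def using l0 qpos by (rule rate_thin_deriv)
    show "((\<lambda>l. geometric_rate (l * E)) has_real_derivative w / l) (at l)"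
      unfolding w_def e_def using E l0 by (rule geometric_rate_scaled_deriv)
  qed
  have w': "((\<lambda>l. geometric_rate (l * E) - l * E / (l * E + 1)) has_real_derivative
      w / l - e / (e + 1)\<^sup>2 / l) (at l)"
  proof (rule DERIV_diff)
    show "((\<lambda>l. geometric_rate (l * E)) has_real_derivative w / l) (at l)"
      unfolding w_def e_def using E l0 by (rule geometric_rate_scaled_deriv)
    have "((\<lambda>l. l * E / (l * E + 1)) has_real_derivative
      (E * (l * E + 1) - l * E * E) / ((l * E + 1) * (l * E + 1))) (at l)"
      using e by (auto intro!: derivative_eq_intros simp: e_def)
    also have "(E * (l * E + 1) - l * E * E) / ((l * E + 1) * (l * E + 1)) = e / (e + 1)\<^sup>2 / l"
    proof -
      have "l * E / D / l = E / D" for D using l0 by simp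
      moreover have "E * (l * E + 1) - l * E * E = E" by (simp add: algebra_simps)
      ultimately show ?thesis unfolding e_def power2_eq_square by (simp only:)
    qed
    finally show "((\<lambda>l. l * E / (l * E + 1)) has_real_derivative e / (e + 1)\<^sup>2 / l) (at l)" .
  qed
  have "(f has_real_derivative ((R - w) / l * w - D * (w / l - e / (e + 1)\<^sup>2 / l)) / (w * w)) (at l)"
    unfolding f_def using DERIV_divide[OF D' w'] w0
    by (simp add: D_def w_def q_def e_def)
  moreover have "((R - w) / l * w - D * (w / l - e / (e + 1)\<^sup>2 / l)) / (w * w) \<le> 0"
  proof -
    have "R - w \<le> D + (Y - 1 / (e + 1))"
    proof -
      have "e / (e + 1) = 1 - 1 / (e + 1)" using e by (simp add: field_simps)
      then show ?thesis using R by (simp add: D_def w_def)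
    qed
    then have "(R - w) * w \<le> (D + (Y - 1 / (e + 1))) * w" using w0 by (intro mult_right_mono) auto
    then have "(R - w) * w - D * (w - e / (e + 1)\<^sup>2) \<le> 0"
      using key by (simp add: algebra_simps)
    then have "((R - w) * w - D * (w - e / (e + 1)\<^sup>2)) / (l * (w * w)) \<le> 0"
      using l0 w0 by (intro divide_nonpos_pos) auto
    moreover have "(r / l * w - D * (w / l - c / l)) / W = (r * w - D * (w - c)) / (l * W)" for r c W
      by (simp add: diff_divide_distrib right_diff_distrib)
    ultimately show ?thesis by (simp only:)
  qed
  ultimately show "\<exists>y. DERIV f l :> y \<and> y \<le> 0" by blast
qed

text \<open>If the claim failed, the ratio of the preceding lemma would be positive at
  \<open>l = 1\<close>, hence on all of \<open>(0, 1]\<close>, and \<open>K\<close> would increase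
  strictly up to \<open>K 1 = 0\<close>. But \<open>K l \<ge> - g_real (l * E)\<close>, and this
  bound tends to 0 with \<open>l\<close>.\<close>

lemma rate_le_geometric_rate_antimono:
  assumes pos: "\<And>n. n \<le> N \<Longrightarrow> 0 < p n" and dec: "\<And>n. n < N \<Longrightarrow> p (Suc n) \<le> p n"
    and s: "(\<Sum>n\<le>N. p n) = 1" and E: "0 < E" and H: "g_real E = ent N p"
  shows "rate N p \<le> geometric_rate E"
proof (rule ccontr)
  assume neg: "\<not> ?thesis"
  have p1: "rate N (thin N p 1) = rate N p" "ent N (thin N p 1) = ent N p"
    by (auto simp: rate_def ent_def thin_1)
  have gt: "geometric_rate (l * E) < rate N (thin N p l)" if l: "0 < l" "l \<le> 1" for l
  proof -
    have "0 < (rate N (thin N p 1) - geometric_rate (1 * E))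
                  / (geometric_rate (1 * E) - 1 * E / (1 * E + 1))"
      using neg geometric_rate_gt[OF E] by (simp add: p1)
    also have "\<dots> \<le> (rate N (thin N p l) - geometric_rate (l * E))
                  / (geometric_rate (l * E) - l * E / (l * E + 1))"
      using pos dec s E l(1) l(2) by (rule rate_defect_ratio_antimono) auto
    finally show ?thesis
      using geometric_rate_gt[of "l * E"] E l by (simp add: zero_less_divide_iff)
  qed
  define K where "K = (\<lambda>l. ent N (thin N p l) - g_real (l * E))"
  have mono: "K a < K b" if ab: "0 < a" "a < b" "b \<le> 1" for a b
  proof (rule DERIV_pos_imp_increasing[OF ab(2)])
    fix l assume l: "a \<le> l" "l \<le> b"
    have "(K has_real_derivative rate N (thin N p l) / l - geometric_rate (l * E) / l) (at l)"
      unfolding K_def using ab l E pos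
      by (intro DERIV_diff ent_thin_deriv g_real_scaled_deriv thin_pos_of_pos) auto
    moreover have "0 < rate N (thin N p l) / l - geometric_rate (l * E) / l"
      using gt[of l] ab l by (simp add: diff_divide_distrib[symmetric])
    ultimately show "\<exists>y. DERIV K l :> y \<and> 0 < y" by blast
  qed
  have K1: "K 1 = 0" using H by (simp add: K_def p1)
  \<comment> \<open>Any point of \<open>(0, 1)\<close> would serve: to its left, \<open>K\<close>
    stays below this fixed negative value.\<close>
  have Kh: "K (1/2) < 0" using mono[of "1/2" 1] K1 by simp
  have "((\<lambda>l. g_real (l * E)) \<longlongrightarrow> g_real (0 * E)) (at 0 within {0..})"
  proof -
    have "continuous_on {0..} (\<lambda>l. g_real (l * E))"
      using E by (intro continuous_on_compose2[OF g_real_continuous_on]) (auto intro!: continuous_intros)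
    then show ?thesis unfolding continuous_on_def by (rule bspec) simp
  qed
  then have "((\<lambda>l. g_real (l * E)) \<longlongrightarrow> 0) (at_right 0)"
    by (simp add: g_real_0) (metis at_within_Ici_at_right)
  moreover have "\<forall>\<^sub>F l in at_right 0. - K (1/2) \<le> g_real (l * E)"
  proof -
    have "\<forall>\<^sub>F l in at_right 0. l \<in> {0<..<1/2::real}"
      by (intro eventually_at_right_real) simp
    then show ?thesis
    proof eventually_elim
      case (elim l)
      have "0 \<le> ent N (thin N p l)"
        using pos elim s by (intro ent_nonneg thin_nonneg) (auto simp: sum_thin intro: less_imp_le)
      then show ?case using mono[of l "1/2"] elim by (simp add: K_def)
    qed
  qed
  ultimately have "- K (1/2) \<le> 0"
    by (intro tendsto_lowerbound[of _ 0 "at_right (0::real)"]) auto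
  then show False using Kh by simp
qed

text \<open>Rearrangement keeps the entropy, hence \<open>E\<close>, and can only raise the
  rate.\<close>

lemma rate_le_geometric_rate:
  assumes pos: "\<And>n. n \<le> N \<Longrightarrow> 0 < q n" and s: "(\<Sum>n\<le>N. q n) = 1"
    and E: "0 < E" and H: "g_real E = ent N q"
  shows "rate N q \<le> geometric_rate E"
proof -
  obtain r where r: "\<And>n. n \<le> N \<Longrightarrow> 0 < r n" "\<And>n. n < N \<Longrightarrow> r (Suc n) \<le> r n"
    "(\<Sum>n\<le>N. r n) = (\<Sum>n\<le>N. q n)" "ent N r = ent N q" "rate N q \<le> rate N r"
    using antimono_rearrangement[of N q] pos by blast
  have "rate N r \<le> geometric_rate E"
    by (rule rate_le_geometric_rate_antimono) (use r s E H in auto)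
  then show ?thesis using r(5) by simp
qed

text \<open>If \<open>K l < 0\<close>, let \<open>b\<close> be the first later point with
  \<open>K b \<ge> 0\<close>. In between, the geometric law with the current entropy has mean
  \<open>E < x * X\<close>, so the rate is below \<open>geometric_rate (x * X)\<close> and
  \<open>K\<close> decreases, contradicting \<open>K l < 0 \<le> K b\<close>.\<close>

lemma ent_thin_ge_pos_top:
  assumes nn: "\<And>n. n \<le> N \<Longrightarrow> 0 \<le> p n" and top: "0 < p N" and s: "(\<Sum>n\<le>N. p n) = 1"
    and l: "0 < l" "l \<le> 1" and X: "0 < X" and H: "g_real X \<le> ent N p"
  shows "g_real (l * X) \<le> ent N (thin N p l)"
proof (rule ccontr)
  assume neg: "\<not> ?thesis"
  define K where "K = (\<lambda>l. ent N (thin N p l) - g_real (l * X))"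
  have "g_real 0 < g_real X" using strict_mono_onD[OF g_real_strict_mono, of 0 X] X by simp
  then have "0 < ent N p" using H by (simp add: g_real_0)
  have N: "0 < N"
  proof (rule ccontr)
    assume "\<not> 0 < N"
    then show False using s \<open>0 < ent N p\<close> by (simp add: ent_def)
  qed
  have Kl: "K l < 0" using neg by (simp add: K_def)
  have K1: "0 \<le> K 1" using H by (simp add: K_def ent_def thin_1)
  have cont: "continuous_on {l..1} K"
  proof -
    have "continuous_on {l..1} (\<lambda>l. thin N p l n * ln (thin N p l n))" for n
      using nn l by (intro continuous_on_compose2[OF x_ln_x_continuous_on thin_continuous_on])
        (auto intro!: thin_nonneg)
    moreover have "continuous_on {l..1} (\<lambda>l. g_real (l * X))"
      using X l by (intro continuous_on_compose2[OF g_real_continuous_on]) (auto intro!: continuous_intros)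
    ultimately show ?thesis unfolding K_def ent_def
      by (intro continuous_on_diff continuous_on_sum continuous_on_minus)
  qed
  obtain b where b: "l < b" "b \<le> 1" "0 \<le> K b" "\<And>x. l \<le> x \<Longrightarrow> x < b \<Longrightarrow> K x < 0"
  proof -
    define S where "S = {l..1} \<inter> K -` {0..}"
    have "closed S" unfolding S_def by (rule continuous_closed_preimage[OF cont]) auto
    moreover have "S \<noteq> {}" using K1 l unfolding S_def by auto
    moreover have bb: "bdd_below S" unfolding S_def by (rule bdd_belowI[of _ l]) auto
    ultimately have "Inf S \<in> S" by (intro closed_contains_Inf)
    then have I: "l \<le> Inf S" "Inf S \<le> 1" "0 \<le> K (Inf S)" unfolding S_def by auto
    have "K x < 0" if "l \<le> x" "x < Inf S" for x
    proof (rule ccontr)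
      assume "\<not> K x < 0"
      then have "x \<in> S" using that I unfolding S_def by auto
      then show False using cInf_lower[OF _ bb] that by fastforce
    qed
    moreover have "Inf S \<noteq> l" using I Kl by auto
    ultimately show ?thesis using that[of "Inf S"] I by auto
  qed
  have "K b < K l"
  \<comment> \<open>Possibly \<open>b = 1\<close>, where \<open>p\<close> may have zeros;
    differentiability is used only in the open interval, where \<open>thin_pos\<close>
    applies.\<close>
  proof (rule DERIV_neg_imp_decreasing_open[OF b(1)])
    show "continuous_on {l..b} K" by (rule continuous_on_subset[OF cont]) (use b in auto)
    fix x assume x: "l < x" "x < b"
    then have x01: "0 < x" "x < 1" using l b by auto
    define q where "q = thin N p x"
    have qpos: "\<And>n. n \<le> N \<Longrightarrow> 0 < q n"
      unfolding q_def using nn top x01 by (intro thin_pos) auto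
    have qs: "(\<Sum>n\<le>N. q n) = 1" unfolding q_def sum_thin s ..
    have "0 < ent N q" using qpos qs N by (rule ent_pos)
    then obtain E where E: "0 \<le> E" "g_real E = ent N q"
      using bij_betw_imp_surj_on[OF g_real_bij_betw] by (metis atLeast_iff imageE less_imp_le)
    have "E \<noteq> 0" using E \<open>0 < ent N q\<close> by (auto simp: g_real_0)
    have "g_real E < g_real (x * X)" using b(4)[of x] x E by (simp add: K_def q_def)
    then have EX: "E < x * X"
      using strict_mono_on_less[OF g_real_strict_mono, of E "x * X"] E(1) X x01 by simp
    have "rate N q \<le> geometric_rate E"
      by (rule rate_le_geometric_rate) (use qpos qs E \<open>E \<noteq> 0\<close> in auto)
    also have "\<dots> < geometric_rate (x * X)"
      using E \<open>E \<noteq> 0\<close> EX by (intro geometric_rate_strict_mono) auto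
    finally have "rate N q / x - geometric_rate (x * X) / x < 0"
      using x01 by (simp add: diff_divide_distrib[symmetric] divide_neg_pos)
    moreover have "(K has_real_derivative rate N q / x - geometric_rate (x * X) / x) (at x)"
      unfolding K_def q_def using x01 X qpos
      by (intro DERIV_diff ent_thin_deriv g_real_scaled_deriv) (auto simp: q_def)
    ultimately show "\<exists>y. DERIV K x :> y \<and> y < 0" by blast
  qed
  then show False using Kl b(3) by simp
qed

text \<open>Cutting at the largest point \<open>M\<close> of the support makes the top mass positive
  and changes neither entropy.\<close>

lemma ent_thin_ge:
  assumes nn: "\<And>n. n \<le> N \<Longrightarrow> 0 \<le> p n" and s: "(\<Sum>n\<le>N. p n) = 1"
    and l: "0 < l" "l \<le> 1" and X: "0 < X" and H: "g_real X \<le> ent N p"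
  shows "g_real (l * X) \<le> ent N (thin N p l)"
proof -
  define M where "M = Max {n. n \<le> N \<and> p n \<noteq> 0}"
  have "\<exists>n\<le>N. p n \<noteq> 0" using s by (metis (mono_tags, lifting) atMost_iff sum.neutral zero_neq_one)
  then have M: "M \<le> N" "p M \<noteq> 0"
    unfolding M_def using Max_in[of "{n. n \<le> N \<and> p n \<noteq> 0}"] by auto
  have z: "p n = 0" if "M < n" "n \<le> N" for n
    using Max_ge[of "{n. n \<le> N \<and> p n \<noteq> 0}" n] that unfolding M_def by fastforce
  have sub: "{..M} \<subseteq> {..N}" using M by auto
  have t: "thin N p l n = thin M p l n" for n
    unfolding thin_def using sub z by (intro sum.mono_neutral_right) auto
  have "ent N p = ent M p"
    unfolding ent_def using sub z by (intro sum.mono_neutral_right) auto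
  moreover have "ent N (thin N p l) = ent M (thin M p l)"
    unfolding ent_def t using sub by (intro sum.mono_neutral_right) (auto simp: thin_eq_0)
  moreover have "(\<Sum>n\<le>N. p n) = (\<Sum>n\<le>M. p n)"
    using sub z by (intro sum.mono_neutral_right) auto
  ultimately show ?thesis
    using ent_thin_ge_pos_top[of M p l X] nn s l X H M
    by (simp add: order_less_le) 
qed

subsection \<open>Laws with infinite support\<close>

lemma pmf_nat_sums_1: "(\<lambda>n::nat. pmf p n) sums 1"
proof -
  have "(\<Sum>n. ennreal (pmf p n)) = (\<integral>\<^sup>+n. ennreal (pmf p n) \<partial>count_space UNIV)"
    by (rule nn_integral_count_space_nat[symmetric])
  also have "\<dots> = ennreal 1"
    by (simp add: nn_integral_pmf measure_pmf.emeasure_space_1[of p, simplified])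
  finally have "(\<lambda>n. ennreal (pmf p n)) sums ennreal 1"
    using summable_sums[OF summableI, of "\<lambda>n. ennreal (pmf p n)"] by simp
  then show ?thesis by (subst (asm) sums_ennreal) auto
qed

text \<open>Here \<open>a\<close> is the weight of a truncated law and \<open>t\<close> the
  contribution of the discarded tail. With \<open>q = a * r + t\<close>, the two logarithmic bounds
  add up to \<open>q * (a + t - 1) \<le> 0\<close>.\<close>

lemma ent_term_mixture:
  fixes a r t :: real
  assumes "0 < a" "0 \<le> r" "0 \<le> t" "t \<le> 1 - a"
  shows "a * - (r * ln r) \<le> - ((a * r + t) * ln (a * r + t))"
proof (cases "r = 0")
  case True
  then show ?thesis using ent_term_nonneg[of t] assms by simp
next
  case False
  define q where "q = a * r + t"
  have r: "0 < r" using False assms by simp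
  have q: "0 < q" using r assms by (auto simp: q_def intro: add_pos_nonneg)
  have "a * (r * (ln q - ln r)) \<le> a * (q - r)"
    using assms r q by (intro mult_left_mono mult_ln_diff_le) auto
  moreover have "t * ln q \<le> t * (q - 1)"
    using assms q by (intro mult_left_mono ln_le_minus_one) auto
  moreover have "q * (a + t - 1) \<le> 0"
    using assms q by (intro mult_nonneg_nonpos) auto
  ultimately have "a * (r * (ln q - ln r)) + t * ln q \<le> 0"
    by (simp add: q_def algebra_simps)
  then have "a * - (r * ln r) \<le> - (q * ln q)" by (simp add: q_def algebra_simps)
  then show ?thesis by (simp add: q_def)
qed

text \<open>The error \<open>t\<close> is the tail \<open>k > N\<close> of the thinning series; its
  binomial weights lie between 0 and 1, so the tail mass \<open>1 - a\<close> dominates it.\<close>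

lemma pmf_thinning_truncation:
  fixes n :: nat
  assumes l: "0 \<le> l" "l \<le> 1" and a: "a = (\<Sum>k\<le>N. pmf p k)"
  defines "t \<equiv> pmf (thinning l p) n - thin N (pmf p) l n"
  shows "0 \<le> t" "t \<le> 1 - a"
proof -
  let ?f = "\<lambda>k. real (k choose n) * l ^ n * (1 - l) ^ (k - n)"
  have "(\<lambda>k. ?f k * pmf p k - (if k \<in> {..N} then ?f k * pmf p k else 0)) sums t"
    unfolding t_def thin_def using l by (intro sums_diff pmf_thinning_sums sums_If_finite_set) auto
  then have t: "(\<lambda>k. if k \<le> N then 0 else ?f k * pmf p k) sums t"
    by (rule sums_cong[THEN iffD1, rotated]) auto
  have "(\<lambda>k. pmf p k - (if k \<in> {..N} then pmf p k else 0)) sums (1 - a)"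
    unfolding a by (intro sums_diff pmf_nat_sums_1 sums_If_finite_set) auto
  then have s: "(\<lambda>k. if k \<le> N then 0 else pmf p k) sums (1 - a)"
    by (rule sums_cong[THEN iffD1, rotated]) auto
  show "0 \<le> t"
    by (rule sums_le[OF _ sums_zero t]) (use l in auto)
  have f1: "?f k \<le> 1" for k
    using pmf_le_1[of "binomial_pmf k l" n] l by simp
  show "t \<le> 1 - a"
    by (rule sums_le[OF _ t s]) (use f1 in \<open>auto intro: mult_left_le_one_le simp: l\<close>)
qed

text \<open>The finite case is applied to \<open>p\<close> conditioned on \<open>{..N}\<close>,
  whose entropy is \<open>h N / a N + ln (a N)\<close>. By \<open>ent_term_mixture\<close>,
  restoring the tail costs at most the factor \<open>a N\<close>, which tends to 1.\<close>

lemma entropy_thinning_ge_real: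
  assumes l: "0 < l" "l \<le> 1" and X: "0 < X" and H: "ennreal (g_real X) < shannon_entropy p"
  shows "ennreal (g_real (l * X)) \<le> shannon_entropy (thinning l p)"
proof -
  define a where "a = (\<lambda>N. \<Sum>k\<le>N. pmf p k)"
  define h where "h = (\<lambda>N. ent N (pmf p))"
  define q where "q = pmf (thinning l p)"
  have a: "a \<longlonglongrightarrow> 1"
    unfolding a_def using pmf_nat_sums_1[of p] by (simp add: sums_def_le)
  have a1: "a N \<le> 1" for N
    unfolding a_def using pmf_nat_sums_1[of p] sum_le_suminf[of "pmf p" "{..N}"]
    by (simp add: sums_iff)
  have h0: "0 \<le> h N" for N
    unfolding h_def ent_def by (intro sum_nonneg ent_term_nonneg) (auto simp: pmf_le_1)
  have hmono: "h M \<le> h N" if "M \<le> N" for M N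
    unfolding h_def ent_def using that
    by (intro sum_mono2 ent_term_nonneg) (auto simp: pmf_le_1)
  have "(\<lambda>N. ennreal (h N)) \<longlonglongrightarrow> shannon_entropy p"
  proof -
    have "(\<lambda>n. ennreal (- (pmf p n * ln (pmf p n)))) sums shannon_entropy p"
      unfolding shannon_entropy_def by (intro summable_sums summableI)
    moreover have "(\<Sum>n\<le>N. ennreal (- (pmf p n * ln (pmf p n)))) = ennreal (h N)" for N
      unfolding h_def ent_def by (intro sum_ennreal ent_term_nonneg) (auto simp: pmf_le_1)
    ultimately show ?thesis unfolding sums_def_le by simp
  qed
  then have "\<forall>\<^sub>F N in sequentially. ennreal (g_real X) < ennreal (h N)"
    using H by (rule order_tendstoD)
  then obtain N0 where "ennreal (g_real X) < ennreal (h N0)"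
    by (auto simp: eventually_sequentially)
  then have N0: "g_real X < h N0" using g_real_nonneg[of X] X by (simp add: ennreal_less_iff)
  \<comment> \<open>The cutoff \<open>N0\<close> secures a strict gap above \<open>g_real X\<close>;
    \<open>N\<close> then grows until the loss \<open>ln (a N)\<close> fits into it.\<close>
  have "(\<lambda>N. h N0 + ln (a N)) \<longlonglongrightarrow> h N0 + ln 1"
    by (intro tendsto_intros a) simp
  then have "\<forall>\<^sub>F N in sequentially. g_real X < h N0 + ln (a N)"
    using N0 by (intro order_tendstoD) auto
  moreover have "\<forall>\<^sub>F N in sequentially. 0 < a N"
    using a by (intro order_tendstoD) auto
  moreover have "\<forall>\<^sub>F N in sequentially. N0 \<le> N" by (rule eventually_ge_at_top)
  ultimately have "\<forall>\<^sub>F N in sequentially. ennreal (a N * g_real (l * X)) \<le> shannon_entropy (thinning l p)"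
  proof eventually_elim
    case (elim N)
    define r where "r = (\<lambda>k. pmf p k / a N)"
    have rs: "(\<Sum>k\<le>N. r k) = 1"
      unfolding r_def sum_divide_distrib[symmetric] using elim(2) by (simp add: a_def)
    have rk: "- (r k * ln (r k)) = - (pmf p k * ln (pmf p k)) / a N + r k * ln (a N)" for k
      using elim(2) by (cases "pmf p k = 0") (auto simp: r_def ln_div pmf_pos field_simps)
    have "ent N r = h N / a N + (\<Sum>k\<le>N. r k) * ln (a N)"
      by (simp only: ent_def h_def rk sum.distrib sum_divide_distrib sum_distrib_right)
    then have "ent N r = h N / a N + ln (a N)" unfolding rs by simp
    moreover have "h N0 \<le> h N / a N"
    proof -
      have "h N0 * a N \<le> h N0 * 1" using h0 a1 by (intro mult_left_mono) auto
      also have "\<dots> \<le> h N" using hmono elim(3) by simp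
      finally show ?thesis using elim(2) by (simp add: field_simps)
    qed
    ultimately have "g_real X \<le> ent N r" using elim(1) by simp
    then have "g_real (l * X) \<le> ent N (thin N r l)"
      using rs elim(2) l X by (intro ent_thin_ge) (auto simp: r_def)
    then have "a N * g_real (l * X) \<le> a N * ent N (thin N r l)"
      using elim(2) by (intro mult_left_mono) auto
    also have "\<dots> \<le> (\<Sum>n\<le>N. - (q n * ln (q n)))"
      unfolding ent_def sum_distrib_left
    proof (intro sum_mono)
      fix n
      define t where "t = q n - thin N (pmf p) l n"
      have "thin N (pmf p) l n = a N * thin N r l n"
        unfolding thin_def r_def sum_distrib_left using elim(2) by (intro sum.cong) auto
      then have "q n = a N * thin N r l n + t" by (simp add: t_def)
      moreover have "0 \<le> t" "t \<le> 1 - a N"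
        using pmf_thinning_truncation[where l=l and a="a N" and N=N and p=p and n=n] l by (simp_all add: t_def q_def a_def)
      moreover have "0 \<le> thin N r l n"
        using l elim(2) by (intro thin_nonneg) (auto simp: r_def)
      ultimately show "a N * - (thin N r l n * ln (thin N r l n)) \<le> - (q n * ln (q n))"
        using ent_term_mixture[of "a N" "thin N r l n" t] elim(2) by simp
    qed
    finally have "ennreal (a N * g_real (l * X)) \<le> ennreal (\<Sum>n\<le>N. - (q n * ln (q n)))"
      by (rule ennreal_leI)
    also have "\<dots> = (\<Sum>n\<le>N. ennreal (- (q n * ln (q n))))"
      by (intro sum_ennreal[symmetric] ent_term_nonneg) (auto simp: q_def pmf_le_1)
    also have "\<dots> \<le> shannon_entropy (thinning l p)"
      unfolding shannon_entropy_def q_def by (intro sum_le_suminf summableI) auto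
    finally show ?case .
  qed
  moreover have "(\<lambda>N. ennreal (a N * g_real (l * X))) \<longlonglongrightarrow> ennreal (1 * g_real (l * X))"
    by (intro tendsto_intros a)
  ultimately have "ennreal (1 * g_real (l * X)) \<le> shannon_entropy (thinning l p)"
    by (intro tendsto_upperbound[of _ _ sequentially]) auto
  then show ?thesis by simp
qed

text \<open>For finite entropy the preceding lemma applies to every mean \<open>x < E\<close>, and
  \<open>x\<close> tends to \<open>E\<close>. For infinite entropy it applies to every mean, so the
  output entropy exceeds every bound.\<close>

lemma entropy_thinning_ge:
  assumes l: "0 \<le> l" "l \<le> 1"
  shows "g_fun (ennreal l * g_inv (shannon_entropy p)) \<le> shannon_entropy (thinning l p)"
proof (cases "l = 0")
  case True
  \<comment> \<open>This includes infinite input entropy, as \<open>0 * top = 0\<close> in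
    \<open>ennreal\<close>.\<close>
  then show ?thesis by (simp add: g_fun_def g_real_0)
next
  case False
  then have l0: "0 < l" using l by simp
  let ?S = "shannon_entropy (thinning l p)"
  have H: "shannon_entropy p = g_fun (g_inv (shannon_entropy p))" by (simp add: g_fun_g_inv)
  show ?thesis
  proof (cases "g_inv (shannon_entropy p)")
    case top
    have Htop: "shannon_entropy p = top" using H unfolding top by (simp add: g_fun_def)
    have "?S = top"
    proof (rule ccontr)
      assume "?S \<noteq> top"
      then obtain s where s: "0 \<le> s" "?S = ennreal s" by (cases ?S) auto
      obtain E where E: "0 \<le> E" "g_real E = s + 1"
        using bij_betw_imp_surj_on[OF g_real_bij_betw] s(1)
        by (metis add_nonneg_nonneg atLeast_iff imageE zero_le_one)
      have "E \<noteq> 0" using E s by (auto simp: g_real_0)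
      \<comment> \<open>Thinning brings the mean \<open>E / l\<close> back to \<open>E\<close>,
        whose entropy \<open>s + 1\<close> exceeds \<open>?S\<close>.\<close>
      have "ennreal (g_real (l * (E / l))) \<le> ?S"
        using l0 l E \<open>E \<noteq> 0\<close> by (intro entropy_thinning_ge_real) (auto simp: Htop)
      then show False using E l0 s by simp
    qed
    then show ?thesis by simp
  next
    case (real E)
    have HE: "shannon_entropy p = ennreal (g_real E)"
      using H real(1) unfolding real(2) by (simp add: g_fun_ennreal)
    have "ennreal (g_real (E * l)) \<le> ?S"
    proof (cases "E = 0")
      case True
      then show ?thesis by (simp add: g_real_0)
    next
      case False
      then have E: "0 < E" using real(1) by simp
      have "isCont (\<lambda>x. g_real (x * l)) E"
        using g_real_scaled_deriv[OF l0 E] by (rule DERIV_isCont)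
      then have "((\<lambda>x. g_real (x * l)) \<longlongrightarrow> g_real (E * l)) (at_left E)"
        unfolding isCont_def by (rule tendsto_within_subset) auto
      then have "((\<lambda>x. ennreal (g_real (x * l))) \<longlongrightarrow> ennreal (g_real (E * l))) (at_left E)"
        by (rule tendsto_ennrealI)
      moreover have "\<forall>\<^sub>F x in at_left E. ennreal (g_real (x * l)) \<le> ?S"
      proof -
        have "\<forall>\<^sub>F x in at_left E. x \<in> {0<..<E}" using E by (intro eventually_at_left_real)
        then show ?thesis
        proof eventually_elim
          case (elim x)
          have "g_real x < g_real E"
            using strict_mono_onD[OF g_real_strict_mono, of x E] elim by simp
          then have "ennreal (g_real x) < shannon_entropy p"
            unfolding HE using g_real_nonneg[of x] elim by (simp add: ennreal_less_iff)
          then show ?case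
            using entropy_thinning_ge_real[OF l0 l(2), of x p] elim by (simp add: mult.commute)
        qed
      qed
      ultimately show ?thesis by (intro tendsto_upperbound[of _ _ "at_left E"]) auto
    qed
    then show ?thesis
      unfolding real(2) using real(1) l(1)
      by (simp add: ennreal_mult[symmetric] g_fun_ennreal mult.commute)
  qed
qed

section \<open>Entropy and thinning of geometric laws\<close>

lemma shannon_entropy_geometric_mean:
  assumes "0 \<le> E"
  shows "shannon_entropy (geometric_mean_pmf E) = ennreal (g_real E)"
proof (cases "E = 0")
  case True
  have z: "- (pmf (geometric_mean_pmf 0) n * ln (pmf (geometric_mean_pmf 0) n)) = 0" for n
    by (cases n) (auto simp: pmf_geometric_mean)
  show ?thesis unfolding True shannon_entropy_def z by (simp add: g_real_0)
next
  case False
  then have E: "0 < E" using assms by simp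
  define z where "z = E / (E + 1)"
  define f where "f = pmf (geometric_mean_pmf E)"
  have z: "0 < z" "z < 1" and z1: "1 - z = 1 / (E + 1)" using E by (auto simp: z_def field_simps)
  have f: "f n = (1 - z) * z ^ n" for n
    unfolding f_def z1 using E by (simp add: pmf_geometric_mean z_def)
  have "(\<lambda>n. (1 - z) * (z ^ n * real n)) sums ((1 - z) * (z / (1 - z)\<^sup>2))"
    using z by (intro sums_mult geometric_sums_times_n) auto
  moreover have "(1 - z) * (z / (1 - z)\<^sup>2) = z / (1 - z)"
    using z by (simp add: power2_eq_square)
  moreover have "z / (1 - z) = E" unfolding z1 unfolding z_def using E by simp
  ultimately have m: "(\<lambda>n. f n * real n) sums E" by (simp add: f mult.assoc)
  \<comment> \<open>Since \<open>- ln (f n)\<close> is affine in \<open>n\<close>, only the total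
    mass and the mean \<open>E\<close> enter.\<close>
  have "(\<lambda>n. f n * ln (E + 1) + f n * real n * (ln (E + 1) - ln E))
     sums (1 * ln (E + 1) + E * (ln (E + 1) - ln E))"
    unfolding f_def by (intro sums_add sums_mult2 pmf_nat_sums_1 m[unfolded f_def])
  moreover have "f n * ln (E + 1) + f n * real n * (ln (E + 1) - ln E) = - (f n * ln (f n))" for n
  proof -
    have lnf: "ln (f n) = - ln (E + 1) + real n * (ln E - ln (E + 1))"
      unfolding f z1 unfolding z_def using E by (simp add: ln_mult ln_div ln_realpow)
    show ?thesis unfolding lnf by (simp add: algebra_simps)
  qed
  moreover have "1 * ln (E + 1) + E * (ln (E + 1) - ln E) = g_real E"
    by (simp add: g_real_def algebra_simps)
  ultimately have "(\<lambda>n. - (f n * ln (f n))) sums g_real E" by simp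
  then show ?thesis
    unfolding shannon_entropy_def f_def
    by (intro suminf_ennreal_eq ent_term_nonneg) (auto simp: pmf_le_1)
qed

text \<open>Shifted by \<open>n\<close>, the thinning series is a constant multiple of the negative
  binomial law with parameters \<open>Suc n\<close> and \<open>c\<close>, where
  \<open>1 - c = (1 - l) * z\<close>; its total mass 1 gives the sum.\<close>

lemma thinning_geometric_mean:
  assumes l: "0 \<le> l" "l \<le> 1" and E: "0 \<le> E"
  shows "thinning l (geometric_mean_pmf E) = geometric_mean_pmf (l * E)"
proof (rule pmf_eqI)
  fix n
  define z where "z = E / (E + 1)"
  define c where "c = 1 - (1 - l) * z"
  let ?f = "\<lambda>k. real (k choose n) * l ^ n * (1 - l) ^ (k - n) * pmf (geometric_mean_pmf E) k"
  have cE: "c = (l * E + 1) / (E + 1)" using E by (simp add: c_def z_def field_simps)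
  have "0 \<le> (1 - l) * z" using l E by (simp add: z_def)
  moreover have "0 < c" unfolding cE using l E by (intro divide_pos_pos) (auto intro: add_nonneg_pos)
  ultimately have c: "c \<in> {0<..1}" by (simp add: c_def)
  have "(\<lambda>k. (l * z) ^ n / (E + 1) / c ^ Suc n * pmf (neg_binomial_pmf (Suc n) c) k)
      sums ((l * z) ^ n / (E + 1) / c ^ Suc n * 1)"
    by (intro sums_mult pmf_nat_sums_1)
  also have "(\<lambda>k. (l * z) ^ n / (E + 1) / c ^ Suc n * pmf (neg_binomial_pmf (Suc n) c) k)
      = (\<lambda>k. ?f (k + n))"
  proof
    fix k
    have "(k + n) choose k = (k + n) choose n"
      using binomial_symmetric[of k "k + n"] by simp
    moreover have "1 - c = (1 - l) * z" by (simp add: c_def)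
    ultimately show "(l * z) ^ n / (E + 1) / c ^ Suc n * pmf (neg_binomial_pmf (Suc n) c) k = ?f (k + n)"
      using c E unfolding pmf_neg_binomial[OF c]
      by (simp add: pmf_geometric_mean z_def[symmetric] power_mult_distrib power_add)
  qed
  finally have "?f sums ((l * z) ^ n / (E + 1) / c ^ Suc n * 1)"
    by (subst (asm) sums_zero_iff_shift) (auto simp: binomial_eq_0)
  with pmf_thinning_sums[OF l, of n "geometric_mean_pmf E"]
  have "pmf (thinning l (geometric_mean_pmf E)) n = (l * z) ^ n / (E + 1) / c ^ Suc n"
    using sums_unique2 by fastforce
  also have "\<dots> = ((l * z) / c) ^ n * (1 / (c * (E + 1)))"
    by (simp add: power_divide)
  also have "(l * z) / c = l * E / (l * E + 1)"
    unfolding cE z_def using E by simp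
  also have "c * (E + 1) = l * E + 1" unfolding cE using E by simp
  finally show "pmf (thinning l (geometric_mean_pmf E)) n = pmf (geometric_mean_pmf (l * E)) n"
    using l E by (simp add: pmf_geometric_mean)
qed

text \<open>The first conjunct spells out the minimality of geometric inputs. It follows from the
  second, which is an equality for geometric laws since thinning takes mean \<open>E\<close> to mean
  \<open>l * E\<close>.\<close>

theorem theorem23:
  fixes p :: "nat pmf" and l :: real
  assumes "0 \<le> l" and "l \<le> 1"
  shows "(\<forall>E\<ge>0. shannon_entropy p = shannon_entropy (geometric_mean_pmf E) \<longrightarrow>
            shannon_entropy (thinning l p) \<ge> shannon_entropy (thinning l (geometric_mean_pmf E)))
       \<and> shannon_entropy (thinning l p) \<ge> g_fun (ennreal l * g_inv (shannon_entropy p))"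
proof (intro conjI allI impI)
  show main: "g_fun (ennreal l * g_inv (shannon_entropy p)) \<le> shannon_entropy (thinning l p)"
    by (rule entropy_thinning_ge[OF assms])
  fix E :: real
  assume E: "0 \<le> E" and H: "shannon_entropy p = shannon_entropy (geometric_mean_pmf E)"
  have "g_inv (shannon_entropy p) = ennreal E"
    unfolding H shannon_entropy_geometric_mean[OF E] g_fun_ennreal[OF E, symmetric]
    by (rule g_inv_g_fun)
  then have "g_fun (ennreal l * g_inv (shannon_entropy p)) = ennreal (g_real (l * E))"
    using assms E by (simp add: ennreal_mult[symmetric] g_fun_ennreal)
  also have "\<dots> = shannon_entropy (thinning l (geometric_mean_pmf E))"
    using assms E by (simp add: thinning_geometric_mean shannon_entropy_geometric_mean)
  finally show "shannon_entropy (thinning l (geometric_mean_pmf E)) \<le> shannon_entropy (thinning l p)"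
    using main by simp
qed

end
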